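(* Let $p$ be a prime and $n$ a natural number with $n+1<p$. Let $(A,+,\cdot)$ be a left nilpotent pre-Lie ring of cardinality $p^n$, and define $a\circ b=a+e^{L_{\Omega(a)}}(b)$ (so $(A,\circ)$ is the group of flows). Then $(A,+,\circ)$ is a left brace which is left nilpotent. Moreover, the brace $(A,+,\circ)$ is right nilpotent if and only if the pre-Lie ring $(A,+,\cdot)$ is right nilpotent. Finally, if $(A,+,\cdot_1)$ and $(A,+,\cdot_2)$ are two distinct left nilpotent pre-Lie ring structures on the same abelian group $(A,+)$, then their group-of-flows braces are distinct (i.e. the multiplications $\circ_1,\circ_2$ differ).
   Context: A (left) brace is a set $A$ with binary operations $+,\circ$ such that $(A,+)$ is an abelian group, $(A,\circ)$ is a group, and $a\circ(b+c)+a=a\circ b+a\circ c$ for all $a,b,c$. Write $a*b=a\circ b-a-b$. For additive subgroups $X,Y$, $X*Y$ is the additive subgroup generated by all $x*y$. Set $A^{1}=A^{(1)}=A$, $A^{i+1}=A*A^{i}$, $A^{(i+1)}=A^{(i)}*A$. A brace is left nilpotent if $A^m=0$ for some $m$, right nilpotent if $A^{(m)}=0$ for some $m$. A pre-Lie ring is an abelian group $(A,+)$ with a biadditive product $\cdot$ satisfying $(x\cdot y)\cdot z-x\cdot(y\cdot z)=(y\cdot x)\cdot z-y\cdot(x\cdot z)$. The series $A^i=A\cdot A^{i-1}$, $A^{(i)}=A^{(i-1)}\cdot A$ and left/right nilpotency are defined as for braces with $\cdot$ in place of $*$. Group of flows: let $(A,+,\cdot)$ be a left nilpotent pre-Lie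 ring of cardinality $p^n$ with $p>n+1$ prime. Let $A^{\mathrm{id}}=A\times\mathbb Z$ with $(r,m)+(s,m')=(r+s,m+m')$, $(r,m)\cdot(s,m')=(r\cdot s+ms+m'r,mm')$; identify $A$ with $A\times\{0\}$, put $1=(0,1)$. For $a\in A$ let $L_a(x)=a\cdot x$ and $e^{L_a}(x)=\sum_{j\ge 0}\frac{1}{j!}L_a^j(x)$ for $x\in A^{\mathrm{id}}$ (finite sum since $A^{n+1}=0$; the needed factorials are invertible modulo $p^n$). Let $W(a)=e^{L_a}(1)-1\in A$; $W:A\to A$ is a bijection, with inverse $\Omega$. *)

theory Defs
  imports Main "HOL-Computational_Algebra.Primes"
begin

fun nsm :: "nat \<Rightarrow> 'a::monoid_add \<Rightarrow> 'a" where
  "nsm 0 x = 0"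
| "nsm (Suc k) x = x + nsm k x"

definition zsm :: "int \<Rightarrow> 'a::group_add \<Rightarrow> 'a" where
  "zsm k x = (if 0 \<le> k then nsm (nat k) x else - nsm (nat (- k)) x)"

text \<open>Division by a natural number m (meaningful when multiplication by m is bijective,
  e.g. m coprime to the group order): the unique y with m y = x.\<close>
definition ndiv :: "nat \<Rightarrow> 'a::monoid_add \<Rightarrow> 'a" where
  "ndiv m x = (THE y. nsm m y = x)"

definition add_subgroup :: "'a::ab_group_add set \<Rightarrow> bool" where
  "add_subgroup H \<longleftrightarrow> 0 \<in> H \<and> (\<forall>x\<in>H. \<forall>y\<in>H. x + y \<in> H) \<and> (\<forall>x\<in>H. - x \<in> H)"

definition add_gen :: "'a::ab_group_add set \<Rightarrow> 'a set" where
  "add_gen S = \<Inter>{H. S \<subseteq> H \<and> add_subgroup H}"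

definition set_op :: "('a::ab_group_add \<Rightarrow> 'a \<Rightarrow> 'a) \<Rightarrow> 'a set \<Rightarrow> 'a set \<Rightarrow> 'a set" where
  "set_op f X Y = add_gen {f x y | x y. x \<in> X \<and> y \<in> Y}"

text \<open>left_series f i = A^(i+1): A^1 = A, A^(i+1) = A op A^i.\<close>
fun left_series :: "('a::ab_group_add \<Rightarrow> 'a \<Rightarrow> 'a) \<Rightarrow> nat \<Rightarrow> 'a set" where
  "left_series f 0 = UNIV"
| "left_series f (Suc i) = set_op f UNIV (left_series f i)"

text \<open>right_series f i = A^((i+1)): A^((1)) = A, A^((i+1)) = A^((i)) op A.\<close>
fun right_series :: "('a::ab_group_add \<Rightarrow> 'a \<Rightarrow> 'a) \<Rightarrow> nat \<Rightarrow> 'a set" where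
  "right_series f 0 = UNIV"
| "right_series f (Suc i) = set_op f (right_series f i) UNIV"

definition left_nilpotent :: "('a::ab_group_add \<Rightarrow> 'a \<Rightarrow> 'a) \<Rightarrow> bool" where
  "left_nilpotent f \<longleftrightarrow> (\<exists>m. left_series f m = {0})"

definition right_nilpotent :: "('a::ab_group_add \<Rightarrow> 'a \<Rightarrow> 'a) \<Rightarrow> bool" where
  "right_nilpotent f \<longleftrightarrow> (\<exists>m. right_series f m = {0})"

definition pre_lie :: "('a::ab_group_add \<Rightarrow> 'a \<Rightarrow> 'a) \<Rightarrow> bool" where
  "pre_lie m \<longleftrightarrow>
     (\<forall>x y z. m (x + y) z = m x z + m y z) \<and>
     (\<forall>x y z. m x (y + z) = m x y + m x z) \<and>
     (\<forall>x y z. m (m x y) z - m x (m y z) = m (m y x) z - m y (m x z))"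

definition is_group :: "('a \<Rightarrow> 'a \<Rightarrow> 'a) \<Rightarrow> bool" where
  "is_group c \<longleftrightarrow>
     (\<forall>x y z. c (c x y) z = c x (c y z)) \<and>
     (\<exists>e. (\<forall>x. c e x = x \<and> c x e = x) \<and> (\<forall>x. \<exists>y. c y x = e \<and> c x y = e))"

definition brace :: "('a::ab_group_add \<Rightarrow> 'a \<Rightarrow> 'a) \<Rightarrow> bool" where
  "brace c \<longleftrightarrow> is_group c \<and> (\<forall>a b d. c a (b + d) + a = c a b + c a d)"

definition brace_star :: "('a::ab_group_add \<Rightarrow> 'a \<Rightarrow> 'a) \<Rightarrow> 'a \<Rightarrow> 'a \<Rightarrow> 'a" where
  "brace_star c a b = c a b - a - b"

text \<open>A^id = A \<times> int. L_a(x) = (a,0)\<cdot>x lies in A (second component 0):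
  (a,0)\<cdot>(s,m') = (a\<cdot>s + m' a, 0).\<close>
definition Lid :: "('a::ab_group_add \<Rightarrow> 'a \<Rightarrow> 'a) \<Rightarrow> 'a \<Rightarrow> 'a \<times> int \<Rightarrow> 'a" where
  "Lid m a x = m a (fst x) + zsm (snd x) a"

text \<open>e^{L_a}(x) = \<Sum>_{j=0}^{n} (1/j!) L_a^j(x) on A^id (terms with j > n vanish since A^(n+1)=0).\<close>
definition expL :: "nat \<Rightarrow> ('a::ab_group_add \<Rightarrow> 'a \<Rightarrow> 'a) \<Rightarrow> 'a \<Rightarrow> 'a \<times> int \<Rightarrow> 'a \<times> int" where
  "expL n m a x =
     (fst x + (\<Sum>j\<in>{1..n}. ndiv (fact j) ((m a ^^ (j - 1)) (Lid m a x))), snd x)"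

text \<open>W(a) = e^{L_a}(1) - 1, with 1 = (0,1); the subtraction is componentwise
  on A \<times> int, and the second component of e^{L_a}(1) is 1, so W(a) is the first component minus 0.\<close>
definition Wmap :: "nat \<Rightarrow> ('a::ab_group_add \<Rightarrow> 'a \<Rightarrow> 'a) \<Rightarrow> 'a \<Rightarrow> 'a" where
  "Wmap n m a = fst (expL n m a (0, 1)) - 0"

definition Omega :: "nat \<Rightarrow> ('a::ab_group_add \<Rightarrow> 'a \<Rightarrow> 'a) \<Rightarrow> 'a \<Rightarrow> 'a" where
  "Omega n m = inv (Wmap n m)"

definition flow_circ :: "nat \<Rightarrow> ('a::ab_group_add \<Rightarrow> 'a \<Rightarrow> 'a) \<Rightarrow> 'a \<Rightarrow> 'a \<Rightarrow> 'a" where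
  "flow_circ n m a b = a + fst (expL n m (Omega n m a) (b, 0))"

end

theory Submission
  imports Defs "HOL-Number_Theory.Cong" "HOL-Computational_Algebra.Formal_Power_Series"
    "HOL-Library.Product_Plus" "HOL-Library.Function_Algebras"
begin

text \<open>The operators \<open>L u\<close> on \<open>A \<times> \<int>\<close> form a Lie ring all of whose products of length \<open>n + 1\<close>
  vanish, because \<open>A^(n+1) = 0\<close>. Since the primes up to \<open>n\<close> are invertible on \<open>A\<close>, the
  Baker--Campbell--Hausdorff theorem shows that the exponentials \<open>exp (L u)\<close> are closed under
  products. Such an exponential is recovered from its value at \<open>(0, 1)\<close>: if \<open>exp (L w)\<close> fixes
  \<open>(0, 1)\<close> then, taking logarithms, \<open>w = L w (0, 1) = 0\<close>. Hence \<open>W\<close> is a bijection, and it transports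
  the group of exponentials to \<open>\<circ>\<close>. Finally \<open>a * b = (exp (L (\<Omega> a)) - 1) b\<close>, and the
  exponential series and its logarithm express \<open>*\<close> and the pre-Lie product through each other,
  so that both have the same right series and \<open>\<circ>\<close> determines the pre-Lie product.\<close>

unbundle fps_syntax

section \<open>Additive subgroups and multiples modulo \<open>P\<close>\<close>

lemma add_subgroup_zero: "add_subgroup H \<Longrightarrow> 0 \<in> H"
  and add_subgroup_add: "add_subgroup H \<Longrightarrow> x \<in> H \<Longrightarrow> y \<in> H \<Longrightarrow> x + y \<in> H"
  and add_subgroup_uminus: "add_subgroup H \<Longrightarrow> x \<in> H \<Longrightarrow> - x \<in> H"
  by (auto simp: add_subgroup_def)

lemma add_subgroup_diff: "add_subgroup H \<Longrightarrow> x \<in> H \<Longrightarrow> y \<in> H \<Longrightarrow> x - y \<in> H"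
  by (metis add_subgroup_add add_subgroup_uminus diff_conv_add_uminus)

lemma add_subgroup_sum:
  "add_subgroup H \<Longrightarrow> (\<And>i. i \<in> I \<Longrightarrow> f i \<in> H) \<Longrightarrow> sum f I \<in> H"
  by (induction I rule: infinite_finite_induct) (auto intro: add_subgroup_zero add_subgroup_add)

lemma add_subgroup_of_nat_mult:
  "add_subgroup H \<Longrightarrow> x \<in> H \<Longrightarrow> of_nat k * (x :: 'r::ring_1) \<in> H"
  by (induction k) (auto simp: distrib_right intro: add_subgroup_zero add_subgroup_add)

lemma of_nat_mult_cong:
  fixes x :: "'r::ring_1"
  assumes "of_nat P * x = 0" "[a = b] (mod P)"
  shows "of_nat a * x = of_nat b * x"
proof -
  have red: "of_nat k * x = of_nat (k mod P) * x" for k :: nat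
  proof -
    have "of_nat k * x = of_nat (k div P * P + k mod P) * x" by simp
    also have "\<dots> = of_nat (k div P) * (of_nat P * x) + of_nat (k mod P) * x"
      by (simp only: of_nat_add of_nat_mult distrib_right mult.assoc)
    finally show ?thesis using assms(1) by simp
  qed
  show ?thesis using red[of a] red[of b] assms(2) by (simp add: cong_def)
qed

section \<open>The Baker--Campbell--Hausdorff theorem\<close>

definition ad :: "'r::ring \<Rightarrow> 'r \<Rightarrow> 'r" where
  "ad z a = z * a - a * z"

text \<open>The induction step, by Pascal's rule, common to the next two expansions. Each
  \<open>a (Suc j)\<close> is the commutator of \<open>z\<close> with \<open>a j\<close>; the
  correction \<open>d\<close> allows a sequence with \<open>a 0 = 0\<close> to start afresh at
  \<open>a 1 = d\<close>.\<close>

lemma binomial_commutation: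
  fixes z d :: "'r::ring_1" and a :: "nat \<Rightarrow> 'r"
  assumes "\<And>j. z * a j = a (Suc j) + a j * z - (if j = 0 then d else 0)"
  shows "z * (\<Sum>j\<le>k. of_nat (k choose j) * (a j * z ^ (k - j))) + d * z ^ k
    = (\<Sum>j\<le>Suc k. of_nat (Suc k choose j) * (a j * z ^ (Suc k - j)))"
proof -
  define S where "S = (\<Sum>j\<le>k. of_nat (k choose j) * (a (Suc j) * z ^ (k - j)))"
  define T where "T = (\<Sum>j\<le>k. of_nat (k choose j) * (a j * z ^ (Suc k - j)))"
  have "z * (\<Sum>j\<le>k. of_nat (k choose j) * (a j * z ^ (k - j)))
      = (\<Sum>j\<le>k. of_nat (k choose j) * ((z * a j) * z ^ (k - j)))"
    unfolding sum_distrib_left by (intro sum.cong refl) (metis mult.assoc mult_of_nat_commute)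
  also have "\<dots> = (\<Sum>j\<le>k. of_nat (k choose j) * (a (Suc j) * z ^ (k - j))
      + of_nat (k choose j) * (a j * z ^ (Suc k - j)) - (if j = 0 then d * z ^ k else 0))"
  proof (rule sum.cong[OF refl])
    fix j assume "j \<in> {..k}"
    then have "z ^ (Suc k - j) = z * z ^ (k - j)" by (simp add: Suc_diff_le)
    then show "of_nat (k choose j) * ((z * a j) * z ^ (k - j)) = of_nat (k choose j) * (a (Suc j) * z ^ (k - j))
      + of_nat (k choose j) * (a j * z ^ (Suc k - j)) - (if j = 0 then d * z ^ k else 0)"
      unfolding assms by (simp add: algebra_simps)
  qed
  also have "\<dots> = S + T - d * z ^ k"
    by (simp add: S_def T_def sum.distrib sum_subtractf sum.delta)
  finally have 1: "z * (\<Sum>j\<le>k. of_nat (k choose j) * (a j * z ^ (k - j))) + d * z ^ k = S + T"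
    by simp
  \<comment> \<open>The added top term has coefficient \<open>k choose Suc k = 0\<close>; it makes
    the index shift line up with \<open>S\<close>.\<close>
  have "T = (\<Sum>j\<le>Suc k. of_nat (k choose j) * (a j * z ^ (Suc k - j)))"
    by (simp add: T_def binomial_eq_0)
  also have "\<dots> = a 0 * z ^ Suc k + (\<Sum>j\<le>k. of_nat (k choose Suc j) * (a (Suc j) * z ^ (k - j)))"
    by (subst sum.atMost_Suc_shift) simp
  finally have "S + T = a 0 * z ^ Suc k
      + (\<Sum>j\<le>k. of_nat (Suc k choose Suc j) * (a (Suc j) * z ^ (k - j)))"
    by (simp add: S_def sum.distrib[symmetric] algebra_simps)
  also have "\<dots> = (\<Sum>j\<le>Suc k. of_nat (Suc k choose j) * (a j * z ^ (Suc k - j)))"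
    by (subst sum.atMost_Suc_shift) simp
  finally show ?thesis using 1 by simp
qed

text \<open>Left multiplication by \<open>z\<close> is the sum of \<open>ad z\<close> and right
  multiplication by \<open>z\<close>. These two commute, so the binomial theorem applies.\<close>

lemma power_mult_ad_expansion:
  fixes z x :: "'r::ring_1"
  shows "z ^ k * x = (\<Sum>j\<le>k. of_nat (k choose j) * ((ad z ^^ j) x * z ^ (k - j)))"
proof (induction k)
  case (Suc k)
  then show ?case
    using binomial_commutation[of z "\<lambda>j. (ad z ^^ j) x" 0 k]
    by (simp add: ad_def[of z "(ad z ^^ j) x" for j] mult.assoc)
qed simp

text \<open>Formally the preceding expansion with \<open>x\<close> the operator d/dt:
  \<open>ad Z\<close> sends d/dt to \<open>- fps_deriv Z\<close>, which uses up one of the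
  \<open>j\<close> commutators.\<close>

lemma fps_deriv_power_ad_expansion:
  fixes Z :: "'r::ring_1 fps"
  shows "fps_deriv (Z ^ k) = (\<Sum>j\<le>k. of_nat (k choose j) *
    ((case j of 0 \<Rightarrow> 0 | Suc i \<Rightarrow> (ad Z ^^ i) (fps_deriv Z)) * Z ^ (k - j)))"
proof (induction k)
  case (Suc k)
  have "Z * (case j of 0 \<Rightarrow> 0 | Suc i \<Rightarrow> (ad Z ^^ i) (fps_deriv Z))
    = (case Suc j of 0 \<Rightarrow> 0 | Suc i \<Rightarrow> (ad Z ^^ i) (fps_deriv Z))
      + (case j of 0 \<Rightarrow> 0 | Suc i \<Rightarrow> (ad Z ^^ i) (fps_deriv Z)) * Z
      - (if j = 0 then fps_deriv Z else 0)" for j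
    by (cases j) (simp_all add: ad_def)
  from binomial_commutation[OF this, of k] Suc show ?case by simp
qed simp

text \<open>The natural numbers \<open>q j\<close> play the role of \<open>1/j!\<close> on elements killed by \<open>P\<close>.\<close>

definition texp :: "nat \<Rightarrow> (nat \<Rightarrow> nat) \<Rightarrow> 'r::ring_1 \<Rightarrow> 'r" where
  "texp n q x = (\<Sum>j\<le>n. of_nat (q j) * x ^ j)"

text \<open>\<open>q 0\<close> is exactly 1, not only modulo \<open>P\<close>, because it multiplies
  the identity, which \<open>P\<close> need not kill.\<close>

locale divided_powers =
  fixes n P :: nat and q :: "nat \<Rightarrow> nat"
  assumes q_0: "q 0 = 1"
    and q_fact: "j \<le> n \<Longrightarrow> [q j * fact j = 1] (mod P)"
begin

lemma q_binomial:
  assumes "j \<le> k" "k \<le> n"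
  shows "[q k * (k choose j) = q j * q (k - j)] (mod P)"
proof -
  have "[q k * (k choose j) * 1 * 1 = q k * (k choose j) * (q j * fact j) * (q (k - j) * fact (k - j))] (mod P)"
    using assms by (intro cong_mult cong_refl cong_sym[OF q_fact]) auto
  moreover have "q k * (k choose j) * (q j * fact j) * (q (k - j) * fact (k - j))
      = (q k * fact k) * (q j * q (k - j))"
    using binomial_fact_lemma[OF assms(1)] by (simp add: algebra_simps)
  moreover have "[(q k * fact k) * (q j * q (k - j)) = 1 * (q j * q (k - j))] (mod P)"
    using assms by (intro cong_mult cong_refl q_fact) auto
  ultimately show ?thesis by (metis cong_trans mult_1 mult_1_right)
qed

lemma q_mult_Suc:
  assumes "Suc k \<le> n"
  shows "[Suc k * (q (Suc k) * fact k) = 1] (mod P)"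
  using q_fact[OF assms] by (simp add: algebra_simps)

text \<open>A Cauchy product. Terms of total index above \<open>n\<close> vanish, so the triangle of
  index pairs may be replaced by the square. The inverse factorials multiply correctly only modulo
  \<open>P\<close>, which suffices for every term except that of index (0, 0).\<close>

lemma divided_sum_eq_mult_texp:
  fixes a :: "nat \<Rightarrow> 'r::ring_1"
  assumes tors: "\<And>i j. 0 < i + j \<Longrightarrow> of_nat P * (a j * z ^ i) = 0"
    and van: "\<And>i j. n < i + j \<Longrightarrow> a j * z ^ i = 0"
  shows "(\<Sum>k\<le>n. of_nat (q k) * (\<Sum>j\<le>k. of_nat (k choose j) * (a j * z ^ (k - j))))
    = (\<Sum>j\<le>n. of_nat (q j) * a j) * texp n q z"
proof -
  let ?g = "\<lambda>j i. of_nat (q j) * of_nat (q i) * (a j * z ^ i)"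
  have "(\<Sum>k\<le>n. of_nat (q k) * (\<Sum>j\<le>k. of_nat (k choose j) * (a j * z ^ (k - j))))
     = (\<Sum>k\<le>n. \<Sum>j\<le>k. ?g j (k - j))"
  proof (intro sum.cong refl, subst sum_distrib_left, intro sum.cong refl)
    fix k j assume "k \<in> {..n}" "j \<in> {..k}"
    then have "of_nat (q k * (k choose j)) * (a j * z ^ (k - j)) = of_nat (q j * q (k - j)) * (a j * z ^ (k - j))"
    proof (cases "k = 0")
      case False
      with \<open>k \<in> {..n}\<close> \<open>j \<in> {..k}\<close> show ?thesis
        by (intro of_nat_mult_cong[OF tors] q_binomial) auto
    qed (simp add: q_0)
    then show "of_nat (q k) * (of_nat (k choose j) * (a j * z ^ (k - j))) = ?g j (k - j)"
      by (simp add: mult.assoc[symmetric])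
  qed
  also have "\<dots> = (\<Sum>(j,i)\<in>{(j,i). j + i \<le> n}. ?g j i)"
    by (rule sum.triangle_reindex_eq[symmetric])
  also have "\<dots> = (\<Sum>(j,i)\<in>{..n} \<times> {..n}. ?g j i)"
    by (rule sum.mono_neutral_left) (auto, metis add.commute mult_zero_right not_le van)
  also have "\<dots> = (\<Sum>j\<le>n. of_nat (q j) * a j) * texp n q z"
    unfolding texp_def sum_product sum.cartesian_product
    by (intro sum.cong refl) (clarsimp, metis mult.assoc mult_of_nat_commute)
  finally show ?thesis .
qed

end

section \<open>Weighted power series over a filtered ring\<close>

locale filtered_ring = divided_powers n P q for n P q +
  fixes F :: "nat \<Rightarrow> 'r::ring_1 set"
  assumes F_subgroup: "add_subgroup (F i)"
    and F_one: "1 \<in> F 0"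
    and F_mult: "x \<in> F i \<Longrightarrow> y \<in> F j \<Longrightarrow> x * y \<in> F (i + j)"
    and F_vanish: "n < i \<Longrightarrow> x \<in> F i \<Longrightarrow> x = 0"
    and F_torsion: "0 < i \<Longrightarrow> x \<in> F i \<Longrightarrow> of_nat P * x = 0"
begin

text \<open>\<open>H r s\<close>: series of order at least \<open>r\<close> in \<open>t\<close> whose coefficient at \<open>t^k\<close> has weight \<open>k + s\<close>.
  Such a series is zero once \<open>r + s > n\<close>, so a differential equation only has to be solved
  up to order \<open>n\<close>.\<close>

definition H :: "nat \<Rightarrow> nat \<Rightarrow> 'r fps set" where
  "H r s = {f. \<forall>k. f $ k \<in> F (k + s) \<and> (k < r \<longrightarrow> f $ k = 0)}"

lemma H_subgroup: "add_subgroup (H r s)"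
  using F_subgroup by (auto simp: add_subgroup_def H_def)

lemmas H_closed = add_subgroup_add[OF H_subgroup] add_subgroup_diff[OF H_subgroup]
  add_subgroup_sum[OF H_subgroup] add_subgroup_of_nat_mult[OF H_subgroup]

lemma H_mult:
  assumes "f \<in> H r s" "g \<in> H r' s'"
  shows "f * g \<in> H (r + r') (s + s')"
proof -
  have "(f * g) $ k \<in> F (k + (s + s'))" for k
    unfolding fps_mult_nth
  proof (rule add_subgroup_sum[OF F_subgroup])
    fix i assume "i \<in> {0..k}"
    then have "k + (s + s') = (i + s) + (k - i + s')" by simp
    moreover have "f $ i \<in> F (i + s)" "g $ (k - i) \<in> F (k - i + s')"
      using assms unfolding H_def by auto
    ultimately show "f $ i * g $ (k - i) \<in> F (k + (s + s'))"
      using F_mult by metis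
  qed
  moreover have "(f * g) $ k = 0" if "k < r + r'" for k
    unfolding fps_mult_nth
  proof (rule sum.neutral, rule ballI)
    fix i assume "i \<in> {0..k}"
    then have "i < r \<or> k - i < r'" using that by auto
    then show "f $ i * g $ (k - i) = 0" using assms by (auto simp: H_def)
  qed
  ultimately show ?thesis by (simp add: H_def)
qed

lemma H_one: "1 \<in> H 0 0"
  using F_one F_subgroup by (auto simp: H_def add_subgroup_def)

lemma H_antimono: "r \<le> r' \<Longrightarrow> f \<in> H r' s \<Longrightarrow> f \<in> H r s"
  by (auto simp: H_def)

lemma H_power: "f \<in> H r 0 \<Longrightarrow> f ^ k \<in> H (k * r) 0"
proof (induction k)
  case (Suc k)
  then show ?case using H_mult[of f r 0 "f ^ k" "k * r" 0] by simp
qed (simp add: H_one)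

lemma H_vanish: "f \<in> H r s \<Longrightarrow> n < r + s \<Longrightarrow> f = 0"
proof (rule fps_ext)
  fix k assume f: "f \<in> H r s" "n < r + s"
  show "f $ k = 0 $ k"
  proof (cases "k < r")
    case False
    then show ?thesis using f F_vanish[of "k + s" "f $ k"] by (simp add: H_def)
  qed (use f in \<open>simp add: H_def\<close>)
qed

lemma fps_of_nat_mult_nth: "(of_nat k * f) $ i = of_nat k * ((f :: 'r fps) $ i)"
  by (induction k) (auto simp: distrib_right)

lemma H_torsion: "f \<in> H r s \<Longrightarrow> 0 < r + s \<Longrightarrow> of_nat P * f = 0"
proof (rule fps_ext)
  fix k assume f: "f \<in> H r s" "0 < r + s"
  show "(of_nat P * f) $ k = 0 $ k"
  proof (cases "k < r")
    case False
    then have "0 < k + s" using f by auto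
    then show ?thesis using f F_torsion[of "k + s" "f $ k"] by (simp add: H_def fps_of_nat_mult_nth)
  qed (use f in \<open>simp add: H_def fps_of_nat_mult_nth\<close>)
qed

text \<open>Differentiation trades one power of \<open>t\<close> for one unit of the weight
  shift.\<close>

lemma H_deriv: "f \<in> H r 0 \<Longrightarrow> fps_deriv f \<in> H (r - 1) 1"
  using add_subgroup_of_nat_mult[OF F_subgroup]
  by (auto simp: H_def simp flip: of_nat_Suc)

lemma H_ad: "z \<in> H r s \<Longrightarrow> a \<in> H r' s' \<Longrightarrow> ad z a \<in> H (r + r') (s + s')"
  using H_mult[of z r s a r' s'] H_mult[of a r' s' z r s]
  by (auto simp: ad_def add.commute intro: H_closed)

lemma H_ad_iter: "z \<in> H 1 0 \<Longrightarrow> a \<in> H 0 1 \<Longrightarrow> (ad z ^^ j) a \<in> H j 1"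
proof (induction j)
  case (Suc j)
  then show ?case using H_ad[of z 1 0 "(ad z ^^ j) a" j 1] by simp
qed simp

lemma H_texp: "z \<in> H 1 0 \<Longrightarrow> texp n q z \<in> H 0 0"
  unfolding texp_def
  by (intro H_closed) (metis H_antimono H_power le0)

text \<open>Conjugation by \<open>exp z\<close> is \<open>exp (ad z)\<close>.\<close>

lemma texp_mult_ad:
  assumes "z \<in> H 1 0" "x \<in> H 0 1"
  shows "texp n q z * x = (\<Sum>j\<le>n. of_nat (q j) * (ad z ^^ j) x) * texp n q z"
proof -
  have "texp n q z * x = (\<Sum>k\<le>n. of_nat (q k) *
      (\<Sum>j\<le>k. of_nat (k choose j) * ((ad z ^^ j) x * z ^ (k - j))))"
    by (simp add: texp_def sum_distrib_right mult.assoc power_mult_ad_expansion)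
  also have "\<dots> = (\<Sum>j\<le>n. of_nat (q j) * (ad z ^^ j) x) * texp n q z"
  proof (rule divided_sum_eq_mult_texp)
    show "of_nat P * ((ad z ^^ j) x * z ^ i) = 0" for i j
      using H_torsion[OF H_ad_iter[OF assms]] by (simp add: mult.assoc[symmetric])
    show "(ad z ^^ j) x * z ^ i = 0" if "n < i + j" for i j
      using H_vanish[OF H_mult[OF H_ad_iter[OF assms, of j] H_power[OF assms(1), of i]]] that
      by simp
  qed
  finally show ?thesis .
qed

text \<open>Noncommutativity turns \<open>z'\<close> into
  \<open>((exp (ad z) - 1) / ad z) z'\<close>: the expansion of the derivative of
  \<open>z ^ k\<close> is fed into the Cauchy product above.\<close>

lemma fps_deriv_texp:
  assumes "z \<in> H 1 0"
  shows "fps_deriv (texp n q z)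
    = (\<Sum>j\<in>{1..n}. of_nat (q j) * (ad z ^^ (j - 1)) (fps_deriv z)) * texp n q z"
proof -
  let ?a = "\<lambda>j. case j of 0 \<Rightarrow> 0 | Suc i \<Rightarrow> (ad z ^^ i) (fps_deriv z)"
  have d: "fps_deriv z \<in> H 0 1" using H_deriv[OF assms] by simp
  have "fps_deriv (texp n q z) = (\<Sum>k\<le>n. of_nat (q k) *
      (\<Sum>j\<le>k. of_nat (k choose j) * (?a j * z ^ (k - j))))"
    unfolding texp_def by (simp add: fps_deriv_sum fps_deriv_power_ad_expansion)
  also have "\<dots> = (\<Sum>j\<le>n. of_nat (q j) * ?a j) * texp n q z"
  proof (rule divided_sum_eq_mult_texp)
    show "of_nat P * (?a j * z ^ i) = 0" for i j
      using H_torsion[OF H_ad_iter[OF assms d]] by (simp add: mult.assoc[symmetric] split: nat.split)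
    show "?a j * z ^ i = 0" if "n < i + j" for i j
    proof (cases j)
      case (Suc l)
      then show ?thesis
        using H_vanish[OF H_mult[OF H_ad_iter[OF assms d, of l] H_power[OF assms, of i]]] that by simp
    qed simp
  qed
  also have "(\<Sum>j\<le>n. of_nat (q j) * ?a j)
      = (\<Sum>j\<in>{1..n}. of_nat (q j) * (ad z ^^ (j - 1)) (fps_deriv z))"
    by (rule sum.mono_neutral_cong_right) (auto split: nat.split)
  finally show ?thesis .
qed

text \<open>The factor \<open>q k * fact (k - 1)\<close> represents \<open>1/k\<close>.\<close>

definition fps_int :: "'r fps \<Rightarrow> 'r fps" where
  "fps_int f = Abs_fps (\<lambda>k. if k = 0 \<or> n < k then 0 else of_nat (q k * fact (k - 1)) * f $ (k - 1))"

lemma fps_deriv_int: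
  assumes "f \<in> H 0 1"
  shows "fps_deriv (fps_int f) = f"
proof (rule fps_ext)
  fix k
  have fk: "f $ k \<in> F (Suc k)" using assms by (simp add: H_def)
  show "fps_deriv (fps_int f) $ k = f $ k"
  proof (cases "Suc k \<le> n")
    case True
    have "of_nat (Suc k * (q (Suc k) * fact k)) * f $ k = of_nat 1 * f $ k"
      by (rule of_nat_mult_cong[OF F_torsion[OF _ fk] q_mult_Suc[OF True]]) simp
    moreover have "fps_deriv (fps_int f) $ k = of_nat (Suc k) * (of_nat (q (Suc k) * fact k) * f $ k)"
      using True by (simp add: fps_int_def del: of_nat_Suc of_nat_mult)
    ultimately show ?thesis by (simp only: of_nat_mult mult.assoc of_nat_1 mult_1)
  next
    \<comment> \<open>Cutting \<open>fps_int\<close> off above \<open>n\<close> loses nothing: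
      \<open>f $ k\<close> has weight \<open>Suc k\<close> and vanishes.\<close>
    case False
    then show ?thesis using F_vanish[OF _ fk] by (simp add: fps_int_def)
  qed
qed

lemma H_int: "f \<in> H 0 1 \<Longrightarrow> fps_int f \<in> H 1 0"
proof -
  assume f: "f \<in> H 0 1"
  have "fps_int f $ k \<in> F k" for k
  proof (cases "k = 0 \<or> n < k")
    case False
    then have "f $ (k - 1) \<in> F k" using f by (auto simp: H_def dest!: spec[of _ "k - 1"])
    then show ?thesis
      unfolding fps_int_def fps_nth_Abs_fps
      using add_subgroup_of_nat_mult[OF F_subgroup] add_subgroup_zero[OF F_subgroup]
      by (auto simp del: of_nat_mult)
  qed (use F_subgroup in \<open>auto simp: fps_int_def add_subgroup_def\<close>)
  then show ?thesis by (simp add: H_def fps_int_def)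
qed

text \<open>Each positive \<open>k \<le> n\<close> is invertible modulo \<open>P\<close>, so a
  vanishing coefficient of the derivative forces the corresponding one of \<open>f\<close> to
  vanish; beyond \<open>n\<close> the weight suffices.\<close>

lemma H_of_deriv:
  assumes "f \<in> H 1 0" "fps_deriv f \<in> H N 1"
  shows "f \<in> H (Suc N) 0"
proof -
  have "f $ k = 0" if "k < Suc N" for k
  proof (cases k)
    case 0
    then show ?thesis using assms(1) by (simp add: H_def)
  next
    case (Suc i)
    have fk: "f $ k \<in> F k" using assms(1) by (simp add: H_def)
    show ?thesis
    proof (cases "k \<le> n")
      case True
      have "fps_deriv f $ i = 0" using assms(2) that Suc unfolding H_def by auto
      then have "of_nat (Suc i) * f $ k = 0" using Suc by simp
      then have "of_nat (q k * fact i) * (of_nat (Suc i) * f $ k) = 0" by simp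
      then have "of_nat (Suc i * (q k * fact i)) * f $ k = 0"
        by (metis mult.assoc mult.commute of_nat_mult)
      moreover have "of_nat (Suc i * (q k * fact i)) * f $ k = of_nat 1 * f $ k"
        using True Suc F_torsion[OF _ fk] q_mult_Suc[of i] by (intro of_nat_mult_cong) auto
      ultimately show ?thesis by simp
    next
      case False
      then show ?thesis using F_vanish[OF _ fk] by simp
    qed
  qed
  then show ?thesis using assms(1) by (auto simp: H_def)
qed

text \<open>Evaluation at \<open>t = 1\<close>. Coefficients of series in \<open>H 0 0\<close>
  vanish beyond \<open>n\<close>, so there the sum is complete and \<open>ev\<close> is
  multiplicative.\<close>

definition ev :: "'r fps \<Rightarrow> 'r" where
  "ev f = (\<Sum>k\<le>n. f $ k)"

lemma ev_mult:
  assumes "f \<in> H 0 0" "g \<in> H 0 0"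
  shows "ev (f * g) = ev f * ev g"
proof -
  have "ev (f * g) = (\<Sum>k\<le>n. \<Sum>i\<le>k. f $ i * g $ (k - i))"
    by (simp add: ev_def fps_mult_nth atLeast0AtMost)
  also have "\<dots> = (\<Sum>(i,j)\<in>{(i,j). i + j \<le> n}. f $ i * g $ j)"
    by (rule sum.triangle_reindex_eq[symmetric])
  also have "\<dots> = (\<Sum>(i,j)\<in>{..n} \<times> {..n}. f $ i * g $ j)"
  proof (rule sum.mono_neutral_left)
    have "f $ i * g $ j = 0" if "n < i + j" for i j
      using F_vanish[OF that] F_mult[of "f $ i" i "g $ j" j] assms by (simp add: H_def)
    then show "\<forall>x\<in>{..n} \<times> {..n} - {(i, j). i + j \<le> n}. (case x of (i, j) \<Rightarrow> f $ i * g $ j) = 0"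
      by (auto simp flip: not_le)
  qed auto
  also have "\<dots> = ev f * ev g"
    by (simp add: ev_def sum_product sum.cartesian_product)
  finally show ?thesis .
qed

lemma ev_power: "f \<in> H 0 0 \<Longrightarrow> ev (f ^ k) = ev f ^ k"
proof (induction k)
  case 0
  show ?case by (simp add: ev_def sum.delta)
next
  case (Suc k)
  then show ?case using H_power[of f 0 k] by (simp add: ev_mult)
qed

lemma ev_texp: "f \<in> H 0 0 \<Longrightarrow> ev (texp n q f) = texp n q (ev f)"
proof -
  assume f: "f \<in> H 0 0"
  have "ev (texp n q f) = (\<Sum>j\<le>n. \<Sum>k\<le>n. of_nat (q j) * (f ^ j) $ k)"
    unfolding texp_def ev_def
    by (subst sum.swap) (simp add: fps_sum_nth fps_of_nat_mult_nth)
  also have "\<dots> = (\<Sum>j\<le>n. of_nat (q j) * ev (f ^ j))"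
    by (simp add: ev_def sum_distrib_left)
  finally show ?thesis by (simp add: texp_def ev_power[OF f])
qed

end

locale lie_subring = filtered_ring n P q F for n P q and F :: "nat \<Rightarrow> 'r::ring_1 set" +
  fixes \<g> :: "'r set"
  assumes lie_subgroup: "add_subgroup \<g>"
    and lie_F: "\<g> \<subseteq> F 1"
    and lie_bracket: "x \<in> \<g> \<Longrightarrow> y \<in> \<g> \<Longrightarrow> x * y - y * x \<in> \<g>"
begin

definition gfps :: "'r fps set" where
  "gfps = {f. \<forall>k. f $ k \<in> \<g>}"

lemma gfps_subgroup: "add_subgroup gfps"
  using lie_subgroup by (auto simp: add_subgroup_def gfps_def)

lemmas gfps_closed = add_subgroup_add[OF gfps_subgroup] add_subgroup_diff[OF gfps_subgroup]
  add_subgroup_sum[OF gfps_subgroup] add_subgroup_of_nat_mult[OF gfps_subgroup]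

lemma gfps_ad: "z \<in> gfps \<Longrightarrow> a \<in> gfps \<Longrightarrow> ad z a \<in> gfps"
proof -
  assume za: "z \<in> gfps" "a \<in> gfps"
  have "(ad z a) $ k \<in> \<g>" for k
  proof -
    \<comment> \<open>The second convolution is reversed so that matching terms pair up to
      commutators; \<open>\<g>\<close> need not be closed under products.\<close>
    have "(a * z) $ k = (\<Sum>i=0..k. a $ (k - i) * z $ i)"
      unfolding fps_mult_nth by (subst sum.atLeastAtMost_rev) simp
    then have "(ad z a) $ k = (\<Sum>i=0..k. z $ i * a $ (k - i) - a $ (k - i) * z $ i)"
      by (simp add: ad_def fps_mult_nth[of z] sum_subtractf)
    also have "\<dots> \<in> \<g>"
      using za by (intro add_subgroup_sum[OF lie_subgroup] lie_bracket) (auto simp: gfps_def)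
    finally show ?thesis .
  qed
  then show ?thesis by (simp add: gfps_def)
qed

lemma gfps_ad_iter: "z \<in> gfps \<Longrightarrow> a \<in> gfps \<Longrightarrow> (ad z ^^ j) a \<in> gfps"
  by (induction j) (auto intro: gfps_ad)

lemma gfps_deriv: "f \<in> gfps \<Longrightarrow> fps_deriv f \<in> gfps"
  using add_subgroup_of_nat_mult[OF lie_subgroup]
  by (auto simp: gfps_def simp flip: of_nat_Suc)

lemma gfps_int: "f \<in> gfps \<Longrightarrow> fps_int f \<in> gfps"
  using add_subgroup_of_nat_mult[OF lie_subgroup] add_subgroup_zero[OF lie_subgroup]
  by (auto simp: gfps_def fps_int_def simp del: of_nat_mult)

text \<open>\<open>Z' = \<Psi> x y Z\<close> is the equation \<open>((exp (ad Z) - 1) / ad Z) Z' = y + exp (ad Z) x\<close>, solved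
  for the leading term \<open>Z'\<close>.\<close>

definition \<Psi> :: "'r \<Rightarrow> 'r \<Rightarrow> 'r fps \<Rightarrow> 'r fps" where
  "\<Psi> x y z = fps_const y + (\<Sum>j\<le>n. of_nat (q j) * (ad z ^^ j) (fps_const x))
     - (\<Sum>j\<in>{2..n}. of_nat (q j) * (ad z ^^ (j - 1)) (fps_deriv z))"

lemma const_H: "x \<in> \<g> \<Longrightarrow> fps_const x \<in> H 0 1"
  using lie_F add_subgroup_zero[OF F_subgroup] by (auto simp: H_def)

lemma const_gfps: "x \<in> \<g> \<Longrightarrow> fps_const x \<in> gfps"
  using add_subgroup_zero[OF lie_subgroup] by (auto simp: gfps_def)

lemma \<Psi>_mem:
  assumes "x \<in> \<g>" "y \<in> \<g>" "z \<in> H 1 0" "z \<in> gfps"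
  shows "\<Psi> x y z \<in> H 0 1 \<inter> gfps"
proof -
  have "(ad z ^^ j) a \<in> H 0 1" if "a \<in> H 0 1" for j a
    using H_antimono[OF _ H_ad_iter[OF assms(3) that]] by simp
  moreover have "fps_deriv z \<in> H 0 1" using H_deriv[OF assms(3)] by simp
  ultimately show ?thesis
    unfolding \<Psi>_def using assms const_H const_gfps
    by (auto intro!: H_closed gfps_closed gfps_ad_iter gfps_deriv)
qed

text \<open>In \<open>ad w a - ad z b = ad (w - z) a + ad z (a - b)\<close> the factor
  \<open>w - z\<close> already has the higher order in \<open>t\<close>, and \<open>z\<close> has
  order at least 1. So one commutator gains one order, hence \<open>Suc j\<close>.\<close>

lemma ad_iter_diff:
  assumes z: "z \<in> H 1 0" and w: "w \<in> H 1 0" and wz: "w - z \<in> H (Suc N) 0"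
    and a: "a \<in> H 0 1" and b: "b \<in> H 0 1" and ab: "a - b \<in> H N 1"
  shows "(ad w ^^ Suc j) a - (ad z ^^ Suc j) b \<in> H (Suc N) 1"
proof (induction j)
  have step: "ad w a - ad z b \<in> H (Suc N) 1"
    if "a \<in> H 0 1" "a - b \<in> H N 1" for a b
  proof -
    have "ad w a - ad z b = ad (w - z) a + ad z (a - b)"
      by (simp add: ad_def algebra_simps)
    then show ?thesis
      using H_ad[OF wz that(1)] H_ad[OF z that(2)] by (auto intro: H_closed)
  qed
  {
    case 0
    show ?case using step[OF a ab] by simp
  next
    case (Suc j)
    show ?case
      using step[of "(ad w ^^ Suc j) a" "(ad z ^^ Suc j) b"]
        H_antimono[OF le0 H_ad_iter[OF w a, of "Suc j"]] H_antimono[OF _ Suc, of N] by simp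
  }
qed

text \<open>In \<open>\<Psi>\<close> the derivative of \<open>z\<close> occurs only inside at least
  one \<open>ad z\<close>, because its sum starts at 2. Hence the order lost by differentiating is
  regained.\<close>

lemma \<Psi>_contraction:
  assumes x: "x \<in> \<g>" and z: "z \<in> H 1 0" and w: "w \<in> H 1 0" and wz: "w - z \<in> H (Suc N) 0"
  shows "\<Psi> x y w - \<Psi> x y z \<in> H (Suc N) 1"
proof -
  have d: "fps_deriv w - fps_deriv z \<in> H N 1"
    using H_deriv[OF wz] by simp
  have dw: "fps_deriv w \<in> H 0 1" "fps_deriv z \<in> H 0 1"
    using H_deriv[OF w] H_deriv[OF z] by simp_all
  have A: "(ad w ^^ j) (fps_const x) - (ad z ^^ j) (fps_const x) \<in> H (Suc N) 1" for j
    using ad_iter_diff[OF z w wz const_H[OF x] const_H[OF x], of "j - 1"] add_subgroup_zero[OF H_subgroup]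
    by (cases j) auto
  have B: "(ad w ^^ (j - 1)) (fps_deriv w) - (ad z ^^ (j - 1)) (fps_deriv z) \<in> H (Suc N) 1"
    if "j \<in> {2..n}" for j
    using ad_iter_diff[OF z w wz dw d, of "j - 2"] that
    by (metis Suc_1 Suc_diff_le atLeastAtMost_iff diff_Suc_Suc diff_Suc_1 One_nat_def)
  have "\<Psi> x y w - \<Psi> x y z
      = (\<Sum>j\<le>n. of_nat (q j) * ((ad w ^^ j) (fps_const x) - (ad z ^^ j) (fps_const x)))
      - (\<Sum>j\<in>{2..n}. of_nat (q j) * ((ad w ^^ (j - 1)) (fps_deriv w) - (ad z ^^ (j - 1)) (fps_deriv z)))"
    by (simp add: \<Psi>_def right_diff_distrib sum_subtractf)
  also have "\<dots> \<in> H (Suc N) 1"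
    by (intro H_closed A B)
  finally show ?thesis .
qed

text \<open>Picard iteration \<open>w = fps_int (\<Psi> x y z)\<close> starting at 0. The new
  residual is \<open>\<Psi> x y w - \<Psi> x y z\<close>, whose order grows by one at each
  step.\<close>

lemma \<Psi>_solution:
  assumes x: "x \<in> \<g>" and y: "y \<in> \<g>"
  shows "\<exists>z \<in> H 1 0 \<inter> gfps. fps_deriv z = \<Psi> x y z"
proof -
  have "\<exists>z \<in> H 1 0 \<inter> gfps. \<Psi> x y z - fps_deriv z \<in> H N 1" for N
  proof (induction N)
    case 0
    have "0 \<in> H 1 0 \<inter> gfps"
      using add_subgroup_zero[OF H_subgroup] add_subgroup_zero[OF gfps_subgroup] by simp
    then show ?case
      using \<Psi>_mem[OF x y] H_deriv[of 0 1] by (intro bexI[of _ 0]) (auto intro!: H_closed)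
  next
    case (Suc N)
    then obtain z where z: "z \<in> H 1 0" "z \<in> gfps" "\<Psi> x y z - fps_deriv z \<in> H N 1" by auto
    define w where "w = fps_int (\<Psi> x y z)"
    have m: "\<Psi> x y z \<in> H 0 1" "\<Psi> x y z \<in> gfps" using \<Psi>_mem[OF x y z(1,2)] by auto
    have w: "w \<in> H 1 0" "w \<in> gfps" "fps_deriv w = \<Psi> x y z"
      unfolding w_def using m by (blast intro: H_int gfps_int fps_deriv_int)+
    have "w - z \<in> H (Suc N) 0"
      using w z by (intro H_of_deriv H_closed) auto
    from \<Psi>_contraction[OF x z(1) w(1) this, of y] w show ?case by (intro bexI[of _ w]) auto
  qed
  \<comment> \<open>Order \<open>n\<close> together with weight shift 1 exceeds \<open>n\<close>, so
    this residual is zero.\<close>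
  from this[of n] obtain z where z: "z \<in> H 1 0 \<inter> gfps" "\<Psi> x y z - fps_deriv z \<in> H n 1" by auto
  then show ?thesis using H_vanish[OF z(2)] by (intro bexI[of _ z]) auto
qed

lemma texp_nth_0: "z \<in> H 1 0 \<Longrightarrow> texp n q z $ 0 = 1"
proof -
  assume "z \<in> H 1 0"
  then have "z $ 0 = 0" by (simp add: H_def)
  then have "texp n q z $ 0 = (\<Sum>j\<le>n. if j = 0 then 1 else 0)"
    unfolding texp_def fps_sum_nth
    by (intro sum.cong refl) (auto simp: fps_of_nat_mult_nth fps_power_zeroth power_0_left q_0)
  then show ?thesis by simp
qed

text \<open>The difference solves the same linear equation, whose coefficients have weight 1.
  Integrating the equation raises the order of the difference by one, until it exceeds
  \<open>n\<close>.\<close>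

lemma fps_deriv_eq_unique:
  assumes f: "f \<in> H 0 0" "fps_deriv f = fps_const y * f + f * fps_const x"
    and g: "g \<in> H 0 0" "fps_deriv g = fps_const y * g + g * fps_const x"
    and 0: "f $ 0 = g $ 0" and x: "x \<in> \<g>" and y: "y \<in> \<g>"
  shows "f = g"
proof -
  have "f - g \<in> H (Suc N) 0" for N
  proof (induction N)
    case 0
    have "f - g \<in> H 0 0" using f g by (intro H_closed)
    then show ?case using \<open>f $ 0 = g $ 0\<close> by (auto simp: H_def)
  next
    case (Suc N)
    have "fps_deriv (f - g) = fps_const y * (f - g) + (f - g) * fps_const x"
      by (simp add: f g algebra_simps)
    moreover have "fps_const y * (f - g) + (f - g) * fps_const x \<in> H (Suc N) 1"
      using H_mult[OF const_H[OF y] Suc] H_mult[OF Suc const_H[OF x]] by (auto intro: H_closed)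
    ultimately show ?case
      using Suc H_antimono[OF _ Suc, of 1] by (intro H_of_deriv) auto
  qed
  from H_vanish[OF this[of n]] show ?thesis by simp
qed

lemma q_1_mult: "f \<in> H 0 1 \<Longrightarrow> of_nat (q 1) * f = f"
\<comment> \<open>For \<open>n = 0\<close> nothing is known about \<open>q 1\<close>, but then
  \<open>H 0 1\<close> is trivial.\<close>
proof (cases "n = 0")
  case True
  then show "f \<in> H 0 1 \<Longrightarrow> ?thesis" using H_vanish[of f 0 1] by simp
next
  case False
  then show "f \<in> H 0 1 \<Longrightarrow> ?thesis"
    using of_nat_mult_cong[OF H_torsion[of f 0 1], of "q 1" 1] q_fact[of 1] by simp
qed

text \<open>With \<open>Z\<close> the solution in \<open>\<g>[[t]]\<close> of the
  equation \<open>Z' = \<Psi> Z\<close>, the series \<open>exp Z\<close> and \<open>exp (t y) exp (t x)\<close> solve the same linear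
  differential equation \<open>f' = y f + f x\<close>. Evaluate at \<open>t = 1\<close>.\<close>

theorem texp_mult_closed:
  assumes x: "x \<in> \<g>" and y: "y \<in> \<g>"
  shows "\<exists>z\<in>\<g>. texp n q y * texp n q x = texp n q z"
proof -
  obtain z where z: "z \<in> H 1 0" "z \<in> gfps" "fps_deriv z = \<Psi> x y z"
    using \<Psi>_solution[OF x y] by auto
  let ?X = "fps_X * fps_const x" and ?Y = "fps_X * fps_const y"
  have dz: "fps_deriv z \<in> H 0 1" using H_deriv[OF z(1)] by simp
  have XH: "fps_X * fps_const c \<in> H 1 0" if "c \<in> \<g>" for c
    using lie_F that add_subgroup_zero[OF F_subgroup]
    by (auto simp: H_def fps_X_mult_nth)
  \<comment> \<open>The summand for \<open>j = 1\<close> is the derivative of \<open>z\<close>;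
    replacing it by \<open>\<Psi> x y z\<close> cancels the other summands.\<close>
  have "(\<Sum>j\<in>{1..n}. of_nat (q j) * (ad z ^^ (j - 1)) (fps_deriv z))
      = fps_const y + (\<Sum>j\<le>n. of_nat (q j) * (ad z ^^ j) (fps_const x))" (is "?l = ?r")
  proof (cases "n = 0")
    case True
    then show ?thesis using H_vanish[OF const_H[OF x]] H_vanish[OF const_H[OF y]] by simp
  next
    case False
    then have "?l = of_nat (q 1) * fps_deriv z
        + (\<Sum>j\<in>{2..n}. of_nat (q j) * (ad z ^^ (j - 1)) (fps_deriv z))"
      by (subst sum.atLeast_Suc_atMost) (simp_all add: numeral_2_eq_2)
    also have "\<dots> = ?r"
      by (subst q_1_mult[OF dz], subst (1) z(3)) (simp add: \<Psi>_def)
    finally show ?thesis .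
  qed
  then have 1: "fps_deriv (texp n q z) = fps_const y * texp n q z + texp n q z * fps_const x"
    using fps_deriv_texp[OF z(1)] texp_mult_ad[OF z(1) const_H[OF x]]
    by (simp add: distrib_right)
  have dX: "fps_deriv (texp n q (fps_X * fps_const c)) = fps_const c * texp n q (fps_X * fps_const c)"
    and cX: "texp n q (fps_X * fps_const c) * fps_const c = fps_const c * texp n q (fps_X * fps_const c)"
    if c: "c \<in> \<g>" for c
  proof -
    let ?C = "fps_X * fps_const c"
    \<comment> \<open>\<open>t c\<close> commutes with \<open>c\<close>, so both commutator sums
      reduce to their first term.\<close>
    have com: "ad ?C (fps_const c) = 0"
      by (simp add: ad_def fps_eq_iff fps_X_mult_nth mult.assoc)
    have it: "(ad ?C ^^ j) (fps_const c) = (if j = 0 then fps_const c else 0)" for j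
      by (induction j) (auto simp: com, auto simp: ad_def)
    have "texp n q ?C * fps_const c
        = (\<Sum>j\<le>n. of_nat (q j) * (ad ?C ^^ j) (fps_const c)) * texp n q ?C"
      by (rule texp_mult_ad[OF XH[OF c] const_H[OF c]])
    also have "(\<Sum>j\<le>n. of_nat (q j) * (ad ?C ^^ j) (fps_const c)) = fps_const c"
      by (simp add: it if_distrib q_0 sum.delta cong: if_cong)
    finally show "texp n q ?C * fps_const c = fps_const c * texp n q ?C" .
    have "(\<Sum>j\<in>{1..n}. of_nat (q j) * (ad ?C ^^ (j - 1)) (fps_const c)) = fps_const c"
    proof (cases "n = 0")
      case True
      then show ?thesis using H_vanish[OF const_H[OF c]] by simp
    next
      case False
      have "(\<Sum>j\<in>{1..n}. of_nat (q j) * (ad ?C ^^ (j - 1)) (fps_const c))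
         = (\<Sum>j\<in>{1..n}. if j = 1 then of_nat (q 1) * fps_const c else 0)"
        by (rule sum.cong) (auto simp: it)
      then show ?thesis using False q_1_mult[OF const_H[OF c]] by simp
    qed
    then show "fps_deriv (texp n q ?C) = fps_const c * texp n q ?C"
      using fps_deriv_texp[OF XH[OF c]] by simp
  qed
  let ?g = "texp n q ?Y * texp n q ?X"
  have 2: "fps_deriv ?g = fps_const y * ?g + ?g * fps_const x"
    by (simp add: dX[OF x] dX[OF y] cX[OF x] mult.assoc)
  have "texp n q z = ?g"
  proof (rule fps_deriv_eq_unique[OF _ 1 _ 2 _ x y])
    show "texp n q z \<in> H 0 0" by (rule H_texp[OF z(1)])
    show "?g \<in> H 0 0" using H_mult[OF H_texp[OF XH[OF y]] H_texp[OF XH[OF x]]] by simp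
    show "texp n q z $ 0 = ?g $ 0"
      using texp_nth_0[OF z(1)] texp_nth_0[OF XH[OF x]] texp_nth_0[OF XH[OF y]] by simp
  qed
  then have "texp n q (ev z) = texp n q (ev ?Y) * texp n q (ev ?X)"
    using ev_mult[OF H_texp[OF XH[OF y]] H_texp[OF XH[OF x]]]
      ev_texp[OF H_antimono[OF _ z(1)]] ev_texp[OF H_antimono[OF _ XH[OF x]]]
      ev_texp[OF H_antimono[OF _ XH[OF y]]] by simp
  \<comment> \<open>For \<open>n = 0\<close> the coefficient at \<open>t\<close> is cut off by
    \<open>ev\<close>, but then \<open>c = 0\<close>.\<close>
  moreover have "ev (fps_X * fps_const c) = c" if "c \<in> \<g>" for c
  proof (cases "n = 0")
    case True
    then have "c = 0" using F_vanish[of 1 c] lie_F that by auto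
    then show ?thesis by (simp add: ev_def)
  next
    case False
    have "ev (fps_X * fps_const c) = (\<Sum>k\<le>n. if k = 1 then c else 0)"
      unfolding ev_def by (rule sum.cong) (auto simp: fps_X_mult_nth)
    then show ?thesis using False by simp
  qed
  moreover have "ev z \<in> \<g>"
    unfolding ev_def using z(2) by (intro add_subgroup_sum[OF lie_subgroup]) (auto simp: gfps_def)
  ultimately show ?thesis using x y by (intro bexI[of _ "ev z"]) auto
qed

end

section \<open>Generated additive subgroups\<close>

lemma add_gen_subgroup: "add_subgroup (add_gen S)"
  by (auto simp: add_gen_def add_subgroup_def)

lemma add_gen_superset: "S \<subseteq> add_gen S"
  by (auto simp: add_gen_def)

lemma add_gen_least: "S \<subseteq> H \<Longrightarrow> add_subgroup H \<Longrightarrow> add_gen S \<subseteq> H"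
  by (auto simp: add_gen_def)

lemma add_gen_mult:
  fixes S T H :: "'r::ring set"
  assumes H: "add_subgroup H" and "\<And>s t. s \<in> S \<Longrightarrow> t \<in> T \<Longrightarrow> s * t \<in> H"
    and "a \<in> add_gen S" "b \<in> add_gen T"
  shows "a * b \<in> H"
proof -
  have "add_subgroup {a. a * t \<in> H}" for t
    using H by (auto simp: add_subgroup_def distrib_right)
  then have "a * t \<in> H" if "t \<in> T" for t
    using add_gen_least[of S "{a. a * t \<in> H}"] assms that by auto
  moreover have "add_subgroup {b. a * b \<in> H}"
    using H by (auto simp: add_subgroup_def distrib_left)
  ultimately show ?thesis
    using add_gen_least[of T "{b. a * b \<in> H}"] assms by auto
qed

section \<open>Logarithms\<close>

context divided_powers
begin

text \<open>For \<open>k > 0\<close> the alternating sum of the \<open>k choose j\<close> is zero,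
  so only the constant term of the Cauchy product survives.\<close>

lemma texp_minus_mult_texp:
  fixes x :: "'r::ring_1"
  assumes nil: "x ^ Suc n = 0" and tors: "of_nat P * x = 0"
  shows "texp n q (- x) * texp n q x = 1"
proof -
  have pw: "(- x) ^ j * x ^ i = (- 1) ^ j * x ^ (i + j)" for i j
    by (simp add: power_minus[of x] mult.assoc power_add[symmetric] add.commute)
  have nil': "x ^ k = 0" if "n < k" for k
  proof -
    have "x ^ k = x ^ Suc n * x ^ (k - Suc n)" using that by (simp only: power_add[symmetric]) simp
    then show ?thesis using nil by simp
  qed
  have tors': "of_nat P * (- x) ^ j * x ^ i = 0" if "0 < i + j" for i j
  proof -
    have "of_nat P * ((- x) ^ j * x ^ i) = (- 1) ^ j * (of_nat P * x ^ (i + j))"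
      unfolding pw by (metis mult.assoc mult_of_nat_commute)
    also have "of_nat P * x ^ (i + j) = of_nat P * x * x ^ (i + j - 1)"
      using that by (metis mult.assoc power_eq_if less_not_refl)
    finally show ?thesis using tors by (simp add: mult.assoc)
  qed
  have "texp n q (- x) * texp n q x = (\<Sum>j\<le>n. of_nat (q j) * (- x) ^ j) * texp n q x"
    by (simp add: texp_def)
  also have "\<dots> = (\<Sum>k\<le>n. of_nat (q k) * (\<Sum>j\<le>k. of_nat (k choose j) * ((- x) ^ j * x ^ (k - j))))"
    by (rule divided_sum_eq_mult_texp[symmetric])
      (use tors' pw nil' in \<open>simp_all add: mult.assoc\<close>)
  also have "\<dots> = (\<Sum>k\<le>n. if k = 0 then 1 else 0)"
  proof (intro sum.cong refl)
    fix k
    have "(\<Sum>j\<le>k. of_nat (k choose j) * ((- x) ^ j * x ^ (k - j)))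
       = of_int (\<Sum>j\<le>k. (- 1) ^ j * of_nat (k choose j)) * x ^ k"
      unfolding pw of_int_sum sum_distrib_right
      by (intro sum.cong refl) (simp, metis mult.assoc mult_of_nat_commute)
    then show "of_nat (q k) * (\<Sum>j\<le>k. of_nat (k choose j) * ((- x) ^ j * x ^ (k - j)))
        = (if k = 0 then 1 else 0)"
      by (cases "k = 0") (simp_all add: q_0 choose_alternating_sum del: of_int_sum)
  qed
  finally show ?thesis by simp
qed

text \<open>The logarithm: \<open>x\<close> is an integral polynomial without constant term in \<open>exp x - 1\<close>.\<close>

lemma texp_log_mem:
  fixes x :: "'r::ring_1"
  assumes nil: "x ^ Suc n = 0" and tors: "of_nat P * x = 0"
    and G: "add_subgroup G" and pow: "\<And>k. (texp n q x - 1) ^ Suc k \<in> G"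
  shows "x \<in> G"
proof -
  define y where "y = texp n q x - 1"
  \<comment> \<open>\<open>X\<close> filters the span of the powers of \<open>x\<close>. Since
    \<open>y - x\<close> lies in \<open>X 2\<close>, \<open>y ^ i\<close> and \<open>x ^ i\<close>
    have the same leading term.\<close>
  define X where "X i = add_gen {x ^ j | j. i \<le> j}" for i
  have X_sub: "add_subgroup (X i)" for i
    unfolding X_def by (rule add_gen_subgroup)
  have X_pow: "x ^ j \<in> X i" if "i \<le> j" for i j
    unfolding X_def using that add_gen_superset by fastforce
  have X_mult: "a * b \<in> X (i + j)" if "a \<in> X i" "b \<in> X j" for a b i j
  proof (rule add_gen_mult[OF X_sub _ that[unfolded X_def]])
    fix s t assume "s \<in> {x ^ k |k. i \<le> k}" "t \<in> {x ^ k |k. j \<le> k}"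
    then obtain k l where "s = x ^ k" "t = x ^ l" "i \<le> k" "j \<le> l" by auto
    then show "s * t \<in> X (i + j)" using X_pow[of "i + j" "k + l"] by (simp add: power_add)
  qed
  have y_sum: "y = (\<Sum>j\<in>{1..n}. of_nat (q j) * x ^ j)"
    by (simp add: y_def texp_def atMost_atLeast0 sum.atLeast_Suc_atMost q_0)
  have yX: "y \<in> X 1"
    unfolding y_sum by (intro add_subgroup_sum[OF X_sub] add_subgroup_of_nat_mult[OF X_sub] X_pow) auto
  have yxX: "y - x \<in> X 2"
  proof (cases "n = 0")
    case True
    then show ?thesis using nil add_subgroup_zero[OF X_sub] by (simp add: y_sum)
  next
    case False
    have "of_nat (q 1) * x = of_nat 1 * x"
      using q_fact[of 1] False by (intro of_nat_mult_cong[OF tors]) simp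
    then have "y - x = (\<Sum>j\<in>{2..n}. of_nat (q j) * x ^ j)"
      using False by (simp add: y_sum sum.atLeast_Suc_atMost numeral_2_eq_2)
    also have "\<dots> \<in> X 2"
      by (intro add_subgroup_sum[OF X_sub] add_subgroup_of_nat_mult[OF X_sub] X_pow) auto
    finally show ?thesis .
  qed
  have diff: "y ^ i - x ^ i \<in> X (Suc i)" for i
  proof (induction i)
    case 0
    then show ?case using add_subgroup_zero[OF X_sub] by simp
  next
    case (Suc i)
    have "y ^ Suc i - x ^ Suc i = (y ^ i - x ^ i) * y + x ^ i * (y - x)"
      by (simp add: power_Suc2 algebra_simps del: power_Suc)
    also have "\<dots> \<in> X (Suc (Suc i))"
      using X_mult[OF Suc yX] X_mult[OF X_pow[of i i] yxX]
      by (intro add_subgroup_add[OF X_sub]) auto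
    finally show ?case .
  qed
  \<comment> \<open>Descending induction: all higher powers of \<open>x\<close> are already in
    \<open>G\<close>, hence so is the difference of \<open>y ^ Suc i\<close> and
    \<open>x ^ Suc i\<close>.\<close>
  have "x ^ Suc i \<in> G" for i
  proof (induction "n - i" arbitrary: i rule: less_induct)
    case less
    show ?case
    proof (cases "n \<le> i")
      case True
      then have "x ^ Suc i = x ^ Suc n * x ^ (i - n)" by (simp only: power_add[symmetric]) simp
      then show ?thesis using nil add_subgroup_zero[OF G] by simp
    next
      case False
      have "x ^ j \<in> G" if "Suc (Suc i) \<le> j" for j
        using less[of "j - 1"] that False by (cases j) auto
      then have "X (Suc (Suc i)) \<subseteq> G"
        unfolding X_def by (intro add_gen_least[OF _ G]) auto
      then have "y ^ Suc i - x ^ Suc i \<in> G" using diff[of "Suc i"] by blast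
      from add_subgroup_diff[OF G pow[of i, folded y_def] this] show ?thesis by simp
    qed
  qed
  from this[of 0] show ?thesis by simp
qed

text \<open>Apply the previous lemma to the element \<open>(x, y)\<close> of the ring \<open>R \<times> R\<close>, realised as
  functions on \<open>bool\<close>, and to the diagonal.\<close>

lemma texp_inj:
  fixes x y :: "'r::ring_1"
  assumes "x ^ Suc n = 0" "y ^ Suc n = 0" "of_nat P * x = 0" "of_nat P * y = 0"
    and "texp n q x = texp n q y"
  shows "x = y"
proof -
  define f where "f = (\<lambda>b. if b then x else y)"
  have pw: "(g ^ k) b = g b ^ k" for g :: "bool \<Rightarrow> 'r" and k b
    by (induction k) auto
  have nt: "(of_nat k * g) b = of_nat k * g b" for g :: "bool \<Rightarrow> 'r" and k b
    by (induction k) (auto simp: distrib_right)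
  have tx: "texp n q f b = texp n q (f b)" for b
    unfolding texp_def by (induction n) (auto simp: nt pw)
  have "f \<in> {g. g True = g False}"
  proof (rule texp_log_mem)
    show "f ^ Suc n = 0" "of_nat P * f = 0"
      using assms unfolding fun_eq_iff pw nt f_def by auto
    show "add_subgroup {g :: bool \<Rightarrow> 'r. g True = g False}"
      by (auto simp: add_subgroup_def)
    show "(texp n q f - 1) ^ Suc k \<in> {g. g True = g False}" for k
      unfolding mem_Collect_eq pw using assms(5) tx by (simp add: f_def)
  qed
  then show ?thesis by (simp add: f_def)
qed

end

section \<open>Multiples in abelian groups\<close>

lemma nsm_add: "nsm (j + k) x = nsm j x + nsm k x"
  by (induction j) (auto simp: add.assoc)

lemma nsm_mult: "nsm (j * k) x = nsm j (nsm k x)"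
  by (induction j) (auto simp: nsm_add)

lemma nsm_zero [simp]: "nsm k 0 = 0"
  by (induction k) auto

lemma nsm_plus: "nsm k (x + y) = nsm k x + nsm k (y :: 'a::ab_group_add)"
  by (induction k) (auto simp: algebra_simps)

lemma nsm_Pair_0: "nsm k (x, 0) = (nsm k x, 0 :: int)"
  by (induction k) (auto simp: zero_prod_def)

lemma add_subgroup_nsm: "add_subgroup H \<Longrightarrow> x \<in> H \<Longrightarrow> nsm k x \<in> H"
  by (induction k) (auto intro: add_subgroup_zero add_subgroup_add)

text \<open>Translation by \<open>x\<close> permutes the group, so adding \<open>x\<close> to every
  element does not change the sum of all elements.\<close>

lemma nsm_card: "nsm (card (UNIV :: 'a set)) (x :: 'a::{ab_group_add, finite}) = 0"
proof -
  have "(\<Sum>y\<in>(UNIV :: 'a set). x + y) = (\<Sum>y\<in>UNIV. y)"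
    by (rule sum.reindex_bij_betw) (auto simp: bij_plus_right)
  then have "(\<Sum>y\<in>(UNIV :: 'a set). x) = 0" by (simp add: sum.distrib)
  moreover have "(\<Sum>y\<in>S. x) = nsm (card S) x" if "finite S" for S :: "'a set"
    using that by (induction S rule: finite_induct) auto
  ultimately show ?thesis by simp
qed

lemma nsm_cong: "nsm P x = 0 \<Longrightarrow> [j = k] (mod P) \<Longrightarrow> nsm j x = nsm k x"
proof -
  assume x: "nsm P x = 0" and jk: "[j = k] (mod P)"
  have "nsm i x = nsm (i mod P) x" for i
    using nsm_add[of "i div P * P" "i mod P" x] x by (simp add: nsm_mult)
  from this[of j] this[of k] jk show ?thesis by (simp add: cong_def)
qed

lemma zsm_int_diff: "zsm (int a - int b) x = nsm a x - nsm b (x :: 'a::ab_group_add)"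
proof (cases "b \<le> a")
  case True
  then show ?thesis using nsm_add[of "a - b" b x] by (simp add: zsm_def nat_diff_distrib)
next
  case False
  then show ?thesis using nsm_add[of "b - a" a x] by (simp add: zsm_def nat_diff_distrib)
qed

lemma int_as_diff: obtains a b where "k = int a - int b"
  by (metis int_diff_cases)

lemma zsm_add: "zsm (j + k) (x :: 'a::ab_group_add) = zsm j x + zsm k x"
proof -
  obtain a b c d where "j = int a - int b" "k = int c - int d" by (metis int_as_diff)
  moreover have "int a - int b + (int c - int d) = int (a + c) - int (b + d)" by simp
  ultimately show ?thesis by (simp only: zsm_int_diff nsm_add) simp
qed

lemma zsm_plus: "zsm k (x + y :: 'a::ab_group_add) = zsm k x + zsm k y"
proof -
  obtain a b where "k = int a - int b" by (metis int_as_diff)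
  then show ?thesis by (simp add: zsm_int_diff nsm_plus)
qed

lemma zsm_0 [simp]: "zsm 0 x = 0" and zsm_1 [simp]: "zsm 1 x = x"
  by (simp_all add: zsm_def)

section \<open>The ring of additive operators on \<open>A \<times> \<int>\<close>\<close>

text \<open>A type of its own lets the operators be an instance of \<open>ring_1\<close>, as the
  results above require. The factor \<open>\<int>\<close> ensures \<open>0 \<noteq> 1\<close> even
  for trivial \<open>A\<close>.\<close>

typedef (overloaded) 'a opr = "{f :: 'a::ab_group_add \<times> int \<Rightarrow> 'a \<times> int. \<forall>x y. f (x + y) = f x + f y}"
  morphisms app Opr
  by (rule exI[of _ "\<lambda>x. x"]) auto

setup_lifting type_definition_opr

instantiation opr :: (ab_group_add) ring_1
begin

lift_definition zero_opr :: "'a opr" is "\<lambda>x. 0" by simp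
lift_definition one_opr :: "'a opr" is "\<lambda>x. x" by simp
lift_definition plus_opr :: "'a opr \<Rightarrow> 'a opr \<Rightarrow> 'a opr" is "\<lambda>f g x. f x + g x"
  by (simp add: algebra_simps)
lift_definition minus_opr :: "'a opr \<Rightarrow> 'a opr \<Rightarrow> 'a opr" is "\<lambda>f g x. f x - g x"
  by (simp add: algebra_simps)
lift_definition uminus_opr :: "'a opr \<Rightarrow> 'a opr" is "\<lambda>f x. - f x"
  by (simp add: algebra_simps)
lift_definition times_opr :: "'a opr \<Rightarrow> 'a opr \<Rightarrow> 'a opr" is "\<lambda>f g x. f (g x)"
  by simp

lemma app_0 [simp]: "app 0 x = 0"
  and app_1 [simp]: "app 1 x = x"
  and app_add: "app (f + g) x = app f x + app g x"
  and app_diff: "app (f - g) x = app f x - app g x"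
  and app_uminus: "app (- f) x = - app f x"
  and app_mult: "app (f * g) x = app f (app g x)"
  for f g :: "'a opr"
  by (simp_all add: zero_opr.rep_eq one_opr.rep_eq plus_opr.rep_eq minus_opr.rep_eq
      uminus_opr.rep_eq times_opr.rep_eq)

lemma app_add_right: "app f (x + y) = app f x + app f y" for f :: "'a opr"
  using app[of f] by blast

lemma opr_eqI: "(\<And>x. app f x = app g x) \<Longrightarrow> f = g" for f g :: "'a opr"
  by (metis app_inject ext)

instance
proof
  show "(0 :: 'a opr) \<noteq> 1"
  proof
    assume "(0 :: 'a opr) = 1"
    then have "app (0 :: 'a opr) (0, 1) = app 1 (0, 1)" by simp
    then show False by (simp add: zero_prod_def)
  qed
qed (rule opr_eqI; simp add: app_add app_diff app_uminus app_mult app_add_right add_ac)+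

end

lemma app_zero_right [simp]: "app f 0 = 0"
  using app_add_right[of f 0 0] by simp

lemma app_of_nat_mult: "app (of_nat k * f) x = nsm k (app f x)"
  by (induction k) (auto simp: distrib_right app_add)

lemma app_sum: "app (sum f I) x = (\<Sum>i\<in>I. app (f i) x)"
  by (induction I rule: infinite_finite_induct) (auto simp: app_add)

lemma app_power: "app (f ^ k) x = (app f ^^ k) x"
  by (induction k) (auto simp: app_mult)

text \<open>The elements with second component 1 generate \<open>A \<times> \<int>\<close>. The
  exponentials act on just these through \<open>\<circ>\<close>, so \<open>\<circ>\<close> will
  determine them.\<close>

lemma opr_eqI_affine:
  assumes "\<And>b. app f (b, 1) = app g (b, 1)"
  shows "f = g"
proof -
  define h where "h = f - g"
  have h1: "app h (b, 1) = 0" for b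
    by (simp add: h_def app_diff assms)
  have "app h (b, k) = 0" for b k
  proof (induction k rule: int_induct[where k = 1])
    case base
    show ?case by (rule h1)
  next
    case (step1 i)
    have "app h ((b, i) + (0, 1)) = app h (b, i) + app h (0, 1)" by (rule app_add_right)
    then show ?case using step1 h1 by simp
  next
    case (step2 i)
    have "app h ((b, i - 1) + (0, 1)) = app h (b, i - 1) + app h (0, 1)" by (rule app_add_right)
    then show ?case using step2 h1 by simp
  qed
  then have "h = 0" by (intro opr_eqI) auto
  then show ?thesis by (simp add: h_def)
qed

section \<open>Left and right series\<close>

lemma set_op_subgroup: "add_subgroup (set_op f X Y)"
  unfolding set_op_def by (rule add_gen_subgroup)

lemma set_op_mem: "x \<in> X \<Longrightarrow> y \<in> Y \<Longrightarrow> f x y \<in> set_op f X Y"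
  unfolding set_op_def by (rule subsetD[OF add_gen_superset]) auto

lemma set_op_least:
  "add_subgroup H \<Longrightarrow> (\<And>x y. x \<in> X \<Longrightarrow> y \<in> Y \<Longrightarrow> f x y \<in> H) \<Longrightarrow> set_op f X Y \<subseteq> H"
  unfolding set_op_def by (rule add_gen_least) auto

lemma set_op_mono: "X \<subseteq> X' \<Longrightarrow> Y \<subseteq> Y' \<Longrightarrow> set_op f X Y \<subseteq> set_op f X' Y'"
  by (rule set_op_least[OF set_op_subgroup]) (auto intro: set_op_mem)

lemma add_subgroup_UNIV: "add_subgroup UNIV"
  by (simp add: add_subgroup_def)

lemma left_series_subgroup: "add_subgroup (left_series f i)"
  by (cases i) (auto simp: set_op_subgroup add_subgroup_UNIV)

lemma right_series_subgroup: "add_subgroup (right_series f i)"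
  by (cases i) (auto simp: set_op_subgroup add_subgroup_UNIV)

lemma left_series_Suc_subset: "left_series f (Suc i) \<subseteq> left_series f i"
proof (induction i)
  case (Suc i)
  then show ?case using set_op_mono[OF subset_refl Suc] by simp
qed simp

lemma right_series_Suc_subset: "right_series f (Suc i) \<subseteq> right_series f i"
proof (induction i)
  case (Suc i)
  then show ?case using set_op_mono[OF Suc subset_refl] by simp
qed simp

lemma left_series_antimono: "i \<le> j \<Longrightarrow> left_series f j \<subseteq> left_series f i"
  by (rule lift_Suc_antimono_le[of "left_series f"]) (rule left_series_Suc_subset)

lemma card_add_subgroup_dvd:
  fixes H :: "'a::{ab_group_add, finite} set"
  assumes "add_subgroup H"
  shows "card H dvd card (UNIV :: 'a set)"
proof (rule equiv_imp_dvd_card)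
  let ?r = "{(x, y). y - x \<in> H}"
  show "equiv UNIV ?r"
  proof (rule equivI)
    show "refl ?r" using assms by (auto simp: refl_on_def add_subgroup_def)
    show "sym ?r" using add_subgroup_uminus[OF assms] by (auto simp: sym_def) (metis minus_diff_eq)
    show "trans ?r" using add_subgroup_add[OF assms] by (auto simp: trans_def) (metis diff_add_cancel add_diff_eq)
  qed simp
  show "card H dvd card X" if X: "X \<in> UNIV // ?r" for X
  proof -
    obtain x where "X = ?r `` {x}" using X by (rule quotientE)
    also have "\<dots> = (+) x ` H"
    proof (intro equalityI subsetI)
      fix y assume "y \<in> ?r `` {x}"
      then have "y = x + (y - x)" "y - x \<in> H" by auto
      then show "y \<in> (+) x ` H" by blast
    qed auto
    finally show ?thesis by (simp add: card_image)
  qed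
qed simp

text \<open>If two consecutive terms agree, the series is stationary and hence zero by nilpotency.
  Otherwise each step lowers the exponent of \<open>p\<close> in the order, so \<open>n\<close>
  steps suffice. Index \<open>n\<close> stands for \<open>A^(n+1)\<close>.\<close>

lemma left_series_eq_zero:
  fixes f :: "'a::{ab_group_add, finite} \<Rightarrow> 'a \<Rightarrow> 'a"
  assumes p: "prime p" and card: "card (UNIV :: 'a set) = p ^ n" and nil: "left_nilpotent f"
  shows "left_series f n = {0}"
proof -
  let ?S = "left_series f"
  obtain N where N: "?S N = {0}" using nil by (auto simp: left_nilpotent_def)
  have stat: "?S i = {0}" if "?S (Suc i) = ?S i" for i
  proof -
    have "?S (i + k) = ?S i" for k
      by (induction k) (use that in auto)
    then have "?S i = ?S (i + N)" by simp
    also have "\<dots> \<subseteq> {0}" using left_series_antimono[of N "i + N" f] N by simp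
    finally show ?thesis using add_subgroup_zero[OF left_series_subgroup] by blast
  qed
  have "\<exists>k. card (?S i) = p ^ k \<and> k \<le> n - i" if "i \<le> n" for i
    using that
  proof (induction i)
    case 0
    then show ?case using card by auto
  next
    case (Suc i)
    then obtain k where k: "card (?S i) = p ^ k" "k \<le> n - i" by auto
    obtain l where l: "card (?S (Suc i)) = p ^ l"
      using card_add_subgroup_dvd[OF left_series_subgroup, of f "Suc i"] card p
      by (metis divides_primepow_nat)
    show ?case
    proof (cases "?S (Suc i) = ?S i")
      case True
      then have "card (?S (Suc i)) = p ^ 0" using stat[OF True] by simp
      then show ?thesis by blast
    next
      case False
      then have "card (?S (Suc i)) < card (?S i)"
        using left_series_Suc_subset[of f i] by (intro psubset_card_mono) auto
      then have "l < k" using k l prime_gt_1_nat[OF p] by simp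
      then show ?thesis using k l by (intro exI[of _ l]) auto
    qed
  qed
  from this[of n] have "card (?S n) = 1" by auto
  then show ?thesis using add_subgroup_zero[OF left_series_subgroup, of f n]
    by (metis card_1_singletonE singletonD)
qed

section \<open>The group of flows\<close>

locale flows = divided_powers n P q for n P q +
  fixes m :: "'a::{ab_group_add, finite} \<Rightarrow> 'a \<Rightarrow> 'a"
  assumes pre_lie: "pre_lie m"
    and left_series_n: "left_series m n = {0}"
    and card_P: "card (UNIV :: 'a set) = P"
begin

lemma m_add_left: "m (x + y) z = m x z + m y z"
  and m_add_right: "m x (y + z) = m x y + m x z"
  and m_assoc: "m (m x y) z - m x (m y z) = m (m y x) z - m y (m x z)"
  using pre_lie unfolding pre_lie_def by blast+

lemma m_0_left [simp]: "m 0 x = 0" and m_0_right [simp]: "m x 0 = 0"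
  using m_add_left[of 0 0 x] m_add_right[of x 0 0] by auto

lemma m_minus_left: "m (- x) z = - m x z"
  using m_add_left[of x "- x" z] by (simp add: minus_unique)

lemma m_minus_right: "m x (- y) = - m x y"
  using m_add_right[of x y "- y"] by (simp add: minus_unique)

lemma m_nsm_right: "m x (nsm k y) = nsm k (m x y)"
  by (induction k) (auto simp: m_add_right)

lemma m_zsm_right: "m x (zsm k y) = zsm k (m x y)"
  by (simp add: zsm_def m_nsm_right m_minus_right)

lemma nsm_P: "nsm P (x :: 'a) = 0"
  using nsm_card[of x] card_P by simp

text \<open>\<open>P\<close> kills \<open>A\<close>, so multiplication by \<open>q j\<close> is
  inverse to multiplication by \<open>fact j\<close>, and the description in \<open>ndiv\<close> is
  meaningful.\<close>

lemma ndiv_fact: "j \<le> n \<Longrightarrow> ndiv (fact j) (x :: 'a) = nsm (q j) x"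
  unfolding ndiv_def
proof (rule the_equality)
  assume j: "j \<le> n"
  have eq: "nsm (q j * fact j) y = y" for y :: 'a
    using nsm_cong[OF nsm_P q_fact[OF j]] by simp
  show "nsm (fact j) (nsm (q j) x) = x"
    using eq[of x] unfolding nsm_mult[symmetric] by (simp only: mult.commute)
  show "nsm (fact j) y = x \<Longrightarrow> y = nsm (q j) x" for y
    using eq[of y] by (simp add: nsm_mult)
qed

lift_definition L :: "'a \<Rightarrow> 'a opr" is "\<lambda>u x. (Lid m u x, 0)"
  by (simp add: Lid_def m_add_right zsm_add algebra_simps)

lemma app_L: "app (L u) (s, k) = (m u s + zsm k u, 0)"
  by transfer (simp add: Lid_def)

lemma L_add: "L (u + v) = L u + L v"
  by (rule opr_eqI) (auto simp: app_L app_add m_add_left zsm_plus)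

lemma L_0: "L 0 = 0"
  using L_add[of 0 0] by simp

lemma L_minus: "L (- u) = - L u"
  using L_add[of u "- u"] L_0 by (simp add: minus_unique)

text \<open>On \<open>A\<close> this is the left symmetry of the associator; at
  \<open>(0, 1)\<close> both sides give \<open>m u v - m v u\<close> directly.\<close>

lemma L_bracket: "L u * L v - L v * L u = L (m u v - m v u)"
proof (rule opr_eqI)
  fix x :: "'a \<times> int"
  obtain s k where x: "x = (s, k)" by (cases x)
  have 1: "m (m u v - m v u) s = m (m u v) s - m (m v u) s"
    by (simp only: diff_conv_add_uminus m_add_left m_minus_left)
  have 2: "zsm k (m u v - m v u) = zsm k (m u v) - zsm k (m v u)"
    by (metis zsm_plus diff_add_cancel add_diff_cancel_right')
  have 3: "m u (m v s) - m v (m u s) = m (m u v) s - m (m v u) s"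
    using m_assoc[of u v s] by (metis diff_add_eq_diff_diff_swap diff_diff_eq2 diff_add_eq add_diff_cancel_left' diff_add_cancel)
  have "m u (m v s + zsm k v) - m v (m u s + zsm k u)
      = (m u (m v s) - m v (m u s)) + (zsm k (m u v) - zsm k (m v u))"
    by (simp only: m_add_right m_zsm_right add_diff_add)
  then show "app (L u * L v - L v * L u) x = app (L (m u v - m v u)) x"
    by (simp add: x app_diff app_mult app_L 1 2 3)
qed

lemma L_inj: "L u = L v \<Longrightarrow> u = v"
proof -
  assume "L u = L v"
  then have "app (L u) (0, 1) = app (L v) (0, 1)" by (rule arg_cong)
  then show ?thesis unfolding app_L by simp
qed

text \<open>The chain of \<open>A \<times> \<int>\<close>, \<open>A\<close>, \<open>A^2\<close>, and
  so on, with \<open>A^j\<close> at index \<open>j\<close>. With \<open>(0, 1)\<close> at index 0,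
  every \<open>L u\<close> raises the index by one.\<close>

definition M :: "nat \<Rightarrow> ('a \<times> int) set" where
  "M j = (case j of 0 \<Rightarrow> UNIV | Suc i \<Rightarrow> left_series m i \<times> {0})"

definition F :: "nat \<Rightarrow> 'a opr set" where
  "F i = {f. \<forall>j. \<forall>x\<in>M j. app f x \<in> M (i + j)}"

lemma M_subgroup: "add_subgroup (M j)"
proof (cases j)
  case (Suc i)
  note left_series_subgroup[of m i]
  then show ?thesis
    unfolding Suc M_def add_subgroup_def nat.case zero_prod_def by fastforce
qed (simp add: M_def add_subgroup_def)

lemma F_app: "f \<in> F i \<Longrightarrow> app f x \<in> M i"
proof -
  assume "f \<in> F i"
  then have "\<forall>x\<in>M 0. app f x \<in> M (i + 0)" unfolding F_def by blast
  then show ?thesis by (cases x) (simp add: M_def)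
qed

lemma L_F: "L u \<in> F 1"
  by (auto simp: F_def M_def app_L set_op_mem split: nat.split)

sublocale lie_subring n P q F "range L"
proof unfold_locales
  show "add_subgroup (F i)" for i
    using M_subgroup by (auto simp: add_subgroup_def F_def app_add app_uminus)
  show "1 \<in> F 0" by (simp add: F_def)
  show "x * y \<in> F (i + j)" if "x \<in> F i" "y \<in> F j" for x y i j
    using that by (auto simp: F_def app_mult add.assoc)
  show "x = 0" if "n < i" "x \<in> F i" for x i
  proof (rule opr_eqI)
    fix y
    have "app x y \<in> M i" using that(2) by (rule F_app)
    also have "M i \<subseteq> {0}"
      using that(1) left_series_antimono[of n "i - 1" m] left_series_n
      by (cases i) (auto simp: M_def zero_prod_def)
    finally show "app x y = app 0 y" by simp
  qed
  show "of_nat P * x = 0" if "0 < i" "x \<in> F i" for x i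
  proof (rule opr_eqI)
    fix y
    have "app x y \<in> M i" using that(2) by (rule F_app)
    \<comment> \<open>Positive weight puts the image into \<open>A\<close>, where \<open>P\<close>
      acts as zero.\<close>
    then have "snd (app x y) = 0" using that(1) by (cases i) (auto simp: M_def)
    then have "app x y = (fst (app x y), 0)" by (simp add: prod_eq_iff)
    then have "nsm P (app x y) = 0" using nsm_Pair_0 nsm_P by (metis zero_prod_def)
    then show "app (of_nat P * x) y = app 0 y" by (simp add: app_of_nat_mult)
  qed
  show "add_subgroup (range L)"
    unfolding add_subgroup_def
    by (auto simp: L_add[symmetric] L_minus[symmetric] intro: range_eqI[of _ _ 0] simp: L_0)
  show "range L \<subseteq> F 1" using L_F by auto
  show "x * y - y * x \<in> range L" if "x \<in> range L" "y \<in> range L" for x y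
    using that L_bracket by auto
qed

definition E :: "'a \<Rightarrow> 'a opr" where
  "E u = texp n q (L u)"

lemma L_nil: "L u ^ Suc n = 0"
proof -
  have "L u ^ k \<in> F k" for k
    using F_one F_mult[OF L_F[of u]] by (induction k) auto
  then show ?thesis by (metis F_vanish lessI)
qed

lemma L_torsion: "of_nat P * L u = 0"
  using F_torsion[OF _ L_F] by simp

lemma E_mult: "\<exists>w. E u * E v = E w"
  using texp_mult_closed[of "L v" "L u"] by (auto simp: E_def)

lemma E_inj: "E u = E v \<Longrightarrow> u = v"
  unfolding E_def by (rule L_inj) (rule texp_inj[OF L_nil L_nil L_torsion L_torsion])

lemma E_minus: "E (- u) * E u = 1"
  unfolding E_def L_minus by (rule texp_minus_mult_texp[OF L_nil L_torsion])

lemma E_0: "E 0 = 1"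
proof -
  have "E 0 = (\<Sum>j\<le>n. if j = 0 then 1 else 0)"
    unfolding E_def L_0 texp_def by (intro sum.cong refl) (auto simp: q_0 power_0_left)
  then show ?thesis by simp
qed

lemma L_mem: "add_subgroup G \<Longrightarrow> (\<And>k. (E u - 1) ^ Suc k \<in> G) \<Longrightarrow> L u \<in> G"
  unfolding E_def by (rule texp_log_mem[OF L_nil L_torsion])

text \<open>One application of \<open>L u\<close> makes the integer component 0; from then on
  \<open>L u\<close> acts as \<open>m u\<close>, so \<open>Lid\<close> occurs once per term.\<close>

lemma expL_eq: "expL n m u x = app (E u) x"
proof -
  have pw: "(app (L u) ^^ Suc j) x = ((m u ^^ j) (Lid m u x), 0)" for j
  proof (induction j)
    case 0
    then show ?case by (cases x) (simp add: app_L Lid_def)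
  next
    case (Suc j)
    then show ?case by (simp add: app_L)
  qed
  have "app (E u) x = (\<Sum>j\<le>n. nsm (q j) ((app (L u) ^^ j) x))"
    by (simp add: E_def texp_def app_sum app_of_nat_mult app_power)
  also have "\<dots> = x + (\<Sum>j\<in>{1..n}. nsm (q j) ((app (L u) ^^ j) x))"
    by (simp add: atMost_atLeast0 sum.atLeast_Suc_atMost q_0)
  also have "(\<Sum>j\<in>{1..n}. nsm (q j) ((app (L u) ^^ j) x))
      = (\<Sum>j\<in>{1..n}. (ndiv (fact j) ((m u ^^ (j - 1)) (Lid m u x)), 0))"
  proof (intro sum.cong refl)
    fix j assume "j \<in> {1..n}"
    then show "nsm (q j) ((app (L u) ^^ j) x) = (ndiv (fact j) ((m u ^^ (j - 1)) (Lid m u x)), 0)"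
      using pw[of "j - 1"] by (simp add: nsm_Pair_0 ndiv_fact)
  qed
  finally show ?thesis by (simp add: expL_def prod_eq_iff fst_sum snd_sum)
qed

section \<open>Bijectivity of \<open>W\<close> and the brace axioms\<close>

abbreviation W where "W \<equiv> Wmap n m"
abbreviation \<Omega> where "\<Omega> \<equiv> Omega n m"
abbreviation circ (infixl "\<odot>" 70) where "circ \<equiv> flow_circ n m"
abbreviation star (infixl "\<star>" 70) where "star \<equiv> brace_star (flow_circ n m)"

lemma snd_app_E: "snd (app (E u) x) = snd x"
  by (simp add: expL_eq[symmetric] expL_def)

lemma app_E_01: "app (E u) (0, 1) = (W u, 1)"
  by (simp add: Wmap_def expL_eq prod_eq_iff snd_app_E)

lemma inj_W: "inj W"
proof (rule injI)
  fix u v assume "W u = W v"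
  obtain w where w: "E (- v) * E u = E w" using E_mult by blast
  have "app (E w) (0, 1) = app (E (- v) * E v) (0, 1)"
    by (simp add: w[symmetric] app_mult app_E_01 \<open>W u = W v\<close>)
  then have fix1: "app (E w) (0, 1) = (0, 1)" by (simp add: E_minus)
  \<comment> \<open>The positive powers of \<open>E w - 1\<close> kill \<open>(0, 1)\<close>, hence
    so does the logarithm.\<close>
  have "L w \<in> {f. app f (0, 1) = 0}"
  proof (rule L_mem)
    show "add_subgroup {f :: 'a opr. app f (0, 1) = 0}"
      by (auto simp: add_subgroup_def app_add app_uminus)
    show "(E w - 1) ^ Suc k \<in> {f. app f (0, 1) = 0}" for k
      by (simp add: power_Suc2 app_mult app_diff fix1 del: power_Suc)
  qed
  then have "w = 0" by (simp add: app_L zero_prod_def)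
  then have "E (- v) * E u = E (- v) * E v" using w by (simp add: E_0 E_minus)
  then have "E v * E (- v) * E u = E v * E (- v) * E v" by (simp add: mult.assoc)
  then show "u = v" using E_minus[of "- v"] E_inj by simp
qed

lemma W_\<Omega> [simp]: "W (\<Omega> a) = a" and \<Omega>_W [simp]: "\<Omega> (W u) = u"
  unfolding Omega_def
  by (rule surj_f_inv_f[OF finite_UNIV_inj_surj[OF finite inj_W]], rule inv_f_f[OF inj_W])

text \<open>The slice \<open>(b, 1)\<close> carries the left regular action of
  \<open>\<odot>\<close>, from which the brace axioms are read off.\<close>

lemma app_E_1: "app (E (\<Omega> a)) (b, 1) = (a \<odot> b, 1)"
proof -
  have "app (E (\<Omega> a)) ((b, 0) + (0, 1)) = app (E (\<Omega> a)) (b, 0) + (a, 1)"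
    by (simp only: app_add_right app_E_01 W_\<Omega>)
  then show ?thesis by (simp add: flow_circ_def expL_eq prod_eq_iff snd_app_E)
qed

lemma \<Omega>_eqI: "app (E u) (0, 1) = (a, 1) \<Longrightarrow> \<Omega> a = u"
  by (metis app_E_01 \<Omega>_W fst_conv)

text \<open>A product of exponentials is again an exponential, and these are determined by their
  value at \<open>(0, 1)\<close>.\<close>

lemma E_\<Omega>_circ: "E (\<Omega> (a \<odot> b)) = E (\<Omega> a) * E (\<Omega> b)"
proof -
  obtain w where w: "E (\<Omega> a) * E (\<Omega> b) = E w" using E_mult by blast
  have "app (E w) (0, 1) = (a \<odot> b, 1)"
    by (simp add: w[symmetric] app_mult app_E_01 app_E_1)
  from \<Omega>_eqI[OF this] w show ?thesis by simp
qed

lemma circ_eqI: "app (E (\<Omega> a)) (b, 1) = (c, 1) \<Longrightarrow> a \<odot> b = c"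
  by (simp add: app_E_1)

lemma brace_circ: "brace circ"
  unfolding brace_def is_group_def
proof (intro conjI)
  have assoc: "a \<odot> b \<odot> c = a \<odot> (b \<odot> c)" for a b c
    by (rule circ_eqI) (simp add: E_\<Omega>_circ app_mult app_E_1)
  then show "\<forall>a b c. a \<odot> b \<odot> c = a \<odot> (b \<odot> c)" by blast
  have "\<Omega> 0 = 0" by (rule \<Omega>_eqI) (simp add: E_0)
  then have unit: "0 \<odot> a = a" "a \<odot> 0 = a" for a
    by (auto intro!: circ_eqI simp: E_0 app_E_01)
  have inv: "W (- \<Omega> a) \<odot> a = 0" "a \<odot> W (- \<Omega> a) = 0" for a
    by (rule circ_eqI, metis E_minus \<Omega>_W W_\<Omega> app_1 app_E_01 app_mult)
      (rule circ_eqI, metis E_minus add.inverse_inverse app_1 app_E_01 app_mult)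
  show "\<exists>e. (\<forall>a. e \<odot> a = a \<and> a \<odot> e = a) \<and> (\<forall>a. \<exists>b. b \<odot> a = e \<and> a \<odot> b = e)"
    using unit inv by blast
  have "a \<odot> (b + d) + a = a \<odot> b + a \<odot> d" for a b d
  proof -
    \<comment> \<open>Both arguments equal \<open>(b + d, 2)\<close>; additivity of the operator
      turns this into the brace law.\<close>
    have "app (E (\<Omega> a)) ((b + d, 1) + (0, 1)) = app (E (\<Omega> a)) ((b, 1) + (d, 1))" by simp
    then show ?thesis unfolding app_add_right app_E_1 app_E_01 by simp
  qed
  then show "\<forall>a b d. a \<odot> (b + d) + a = a \<odot> b + a \<odot> d" by blast
qed

lemma app_E_minus_1: "app (E (\<Omega> a) - 1) (b, 0) = (a \<star> b, 0)"
proof -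
  have "app (E (\<Omega> a)) ((b, 0) + (0, 1)) = app (E (\<Omega> a)) (b, 0) + app (E (\<Omega> a)) (0, 1)"
    by (rule app_add_right)
  then have "app (E (\<Omega> a)) (b, 0) = (a \<odot> b - a, 0)"
    by (simp add: app_E_1 app_E_01 prod_eq_iff)
  then show ?thesis by (simp add: app_diff brace_star_def)
qed

section \<open>Comparison of the nilpotency series\<close>

lemma star_eq: "a \<star> b = (\<Sum>j\<in>{1..n}. nsm (q j) ((m (\<Omega> a) ^^ j) b))"
proof -
  have "(a \<star> b, 0) = expL n m (\<Omega> a) (b, 0) - (b, 0)"
    by (simp add: expL_eq app_E_minus_1[symmetric] app_diff)
  then have "a \<star> b = (\<Sum>j\<in>{1..n}. ndiv (fact j) ((m (\<Omega> a) ^^ (j - 1)) (m (\<Omega> a) b)))"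
    by (simp add: expL_def Lid_def)
  also have "\<dots> = (\<Sum>j\<in>{1..n}. nsm (q j) ((m (\<Omega> a) ^^ j) b))"
  proof (intro sum.cong refl)
    fix j assume "j \<in> {1..n}"
    then obtain i where "j = Suc i" "j \<le> n" by (cases j) auto
    then show "ndiv (fact j) ((m (\<Omega> a) ^^ (j - 1)) (m (\<Omega> a) b)) = nsm (q j) ((m (\<Omega> a) ^^ j) b)"
      using funpow_swap1[of "m (\<Omega> a)" i b] ndiv_fact[of j] by simp
  qed
  finally show ?thesis .
qed

lemma star_mem:
  assumes "add_subgroup S" "\<And>j. (m (\<Omega> a) ^^ Suc j) b \<in> S"
  shows "a \<star> b \<in> S"
  unfolding star_eq
proof (intro add_subgroup_sum[OF assms(1)] add_subgroup_nsm[OF assms(1)])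
  fix j assume "j \<in> {1..n}"
  then show "(m (\<Omega> a) ^^ j) b \<in> S" using assms(2)[of "j - 1"] by simp
qed

text \<open>\<open>a \<star> b\<close> is an integral combination of positive iterates of
  \<open>m (\<Omega> a)\<close> at \<open>b\<close>. The inner applications stay in term
  \<open>i\<close>, and the outermost leads to the next.\<close>

lemma left_series_star_subset: "left_series star i \<subseteq> left_series m i"
proof (induction i)
  case (Suc i)
  have "a \<star> b \<in> left_series m (Suc i)" if b: "b \<in> left_series star i" for a b
  proof (rule star_mem[OF left_series_subgroup])
    fix j
    have "(m (\<Omega> a) ^^ j) b \<in> left_series m i"
    proof (induction j)
      case 0
      then show ?case using b Suc by auto
    next
      case (Suc j)
      then have "m (\<Omega> a) ((m (\<Omega> a) ^^ j) b) \<in> left_series m (Suc i)"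
        by (simp add: set_op_mem)
      then show ?case using left_series_Suc_subset[of m i] by auto
    qed
    then show "(m (\<Omega> a) ^^ Suc j) b \<in> left_series m (Suc i)"
      by (simp add: set_op_mem)
  qed
  then show ?case
    using set_op_least[OF left_series_subgroup, of UNIV "left_series star i" star m "Suc i"] by simp
qed simp

lemma left_nilpotent_star: "left_nilpotent star"
proof -
  have "left_series star n = {0}"
    using left_series_star_subset[of n] left_series_n add_subgroup_zero[OF left_series_subgroup[of star n]]
    by auto
  then show ?thesis by (auto simp: left_nilpotent_def)
qed

text \<open>The pre-Lie identity reads \<open>x(sz) = (xs)z + s(xz) - (sx)z\<close>. For
  \<open>s\<close> in term \<open>i\<close> all three left factors lie there: \<open>xs\<close> by
  induction, \<open>sx\<close> because the series descends.\<close>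

lemma right_series_left_ideal: "y \<in> right_series m i \<Longrightarrow> m x y \<in> right_series m i"
proof (induction i arbitrary: x y)
  case (Suc i)
  let ?S = "right_series m (Suc i)"
  have mem: "m s z \<in> ?S" if "s \<in> right_series m i" for s z
    using that by (simp add: set_op_mem)
  have "right_series m (Suc i) \<subseteq> {y. m x y \<in> ?S}"
    unfolding right_series.simps
  proof (rule set_op_least)
    show "add_subgroup {y. m x y \<in> set_op m (right_series m i) UNIV}"
      using set_op_subgroup[of m "right_series m i" UNIV]
      by (auto simp: add_subgroup_def m_add_right m_minus_right)
    fix s z assume s: "s \<in> right_series m i"
    have "m s x \<in> right_series m i"
      using mem[OF s] right_series_Suc_subset[of m i] by blast
    then have "m (m x s) z + m s (m x z) - m (m s x) z \<in> ?S"
      using mem Suc.IH[OF s] s right_series_subgroup[of m "Suc i"]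
      by (intro add_subgroup_diff add_subgroup_add) auto
    moreover have "m x (m s z) = m (m x s) z + m s (m x z) - m (m s x) z"
      using m_assoc[of x s z] by (simp add: algebra_simps)
    ultimately show "s \<in> right_series m i \<Longrightarrow> z \<in> UNIV \<Longrightarrow> m s z \<in> {y. m x y \<in> set_op m (right_series m i) UNIV}"
      by simp
  qed
  then show ?case using Suc.prems by blast
qed simp

text \<open>The logarithm evaluated at a point. After its first application
  \<open>E (\<Omega> a) - 1\<close> acts on \<open>A\<close> as \<open>a \<star>\<close>, so its
  powers stay in \<open>T\<close>. The point \<open>(0, 1)\<close> yields \<open>\<Omega> a\<close>,
  and \<open>(b, 0)\<close> yields \<open>m (\<Omega> a) b\<close>.\<close>

lemma L_mem_at:
  assumes S: "add_subgroup S" and T: "\<And>b. b \<in> T \<Longrightarrow> a \<star> b \<in> T"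
    and first: "app (E (\<Omega> a) - 1) x = (t, 0)" "t \<in> T" and TS: "T \<subseteq> S"
  shows "fst (app (L (\<Omega> a)) x) \<in> S"
proof -
  have "L (\<Omega> a) \<in> {f. snd (app f x) = 0 \<and> fst (app f x) \<in> S}"
  proof (rule L_mem)
    show "add_subgroup {f. snd (app f x) = 0 \<and> fst (app f x) \<in> S}"
      using S by (auto simp: add_subgroup_def app_add app_uminus)
    have "\<exists>s\<in>T. app ((E (\<Omega> a) - 1) ^ Suc k) x = (s, 0)" for k
    proof (induction k)
      case 0
      then show ?case using first by auto
    next
      case (Suc k)
      then obtain s where "s \<in> T" "app ((E (\<Omega> a) - 1) ^ Suc k) x = (s, 0)" by auto
      then have "app ((E (\<Omega> a) - 1) ^ Suc (Suc k)) x = (a \<star> s, 0)"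
        by (simp only: power_Suc[of _ "Suc k"] app_mult app_E_minus_1)
      then show ?case using T[OF \<open>s \<in> T\<close>] by blast
    qed
    then show "(E (\<Omega> a) - 1) ^ Suc k \<in> {f. snd (app f x) = 0 \<and> fst (app f x) \<in> S}" for k
      using TS by (metis (mono_tags, lifting) fst_conv mem_Collect_eq snd_conv subsetD)
  qed
  then show ?thesis by simp
qed

lemma \<Omega>_mem:
  assumes S: "add_subgroup S" and "\<And>b. b \<in> S \<Longrightarrow> a \<star> b \<in> S" and "a \<in> S"
  shows "\<Omega> a \<in> S"
proof -
  have "fst (app (L (\<Omega> a)) (0, 1)) \<in> S"
    by (rule L_mem_at[OF assms(1), where T = S and t = a]) (use assms in \<open>simp_all add: app_diff app_E_01\<close>)
  then show ?thesis by (simp add: app_L)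
qed

lemma right_series_star_subset: "right_series star i \<subseteq> right_series m i"
proof (induction i)
  case (Suc i)
  have "a \<star> b \<in> right_series m (Suc i)" if a: "a \<in> right_series star i" for a b
  proof -
    \<comment> \<open>The weaker inclusion comes first, to place \<open>\<Omega> a\<close> in term
      \<open>i\<close>. Then each summand of \<open>a \<star> b\<close> has
      \<open>\<Omega> a\<close> as its left factor and falls into the next term.\<close>
    have "a \<star> b \<in> right_series m i" if "b \<in> right_series m i" for b
    proof (rule star_mem[OF right_series_subgroup])
      show "(m (\<Omega> a) ^^ Suc j) b \<in> right_series m i" for j
        using that by (induction j) (auto intro: right_series_left_ideal)
    qed
    then have "\<Omega> a \<in> right_series m i"
      using a Suc by (intro \<Omega>_mem right_series_subgroup) auto
    then show ?thesis
      by (intro star_mem right_series_subgroup) (simp add: set_op_mem)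
  qed
  then show ?case
    using set_op_least[OF right_series_subgroup, of "right_series star i" UNIV star m "Suc i"] by simp
qed simp

text \<open>A left factor \<open>u\<close> has to be written as \<open>\<Omega> a\<close> with
  \<open>a\<close> in the same term. \<open>\<Omega>\<close> maps that finite term injectively into
  itself, hence onto it.\<close>

lemma right_series_subset_star: "right_series m i \<subseteq> right_series star i"
proof (induction i)
  case (Suc i)
  let ?J = "right_series star i" and ?J' = "right_series star (Suc i)"
  have star_J': "a \<star> b \<in> ?J'" if "a \<in> ?J" for a b
    using that by (simp add: set_op_mem)
  have star_J: "a \<star> b \<in> ?J" if "a \<in> ?J" for a b
    by (rule subsetD[OF right_series_Suc_subset star_J'[OF that]])
  have "\<Omega> a \<in> ?J" if "a \<in> ?J" for a
    by (rule \<Omega>_mem[OF right_series_subgroup star_J[OF that] that])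
  then have "\<Omega> ` ?J \<subseteq> ?J" by blast
  moreover have "inj_on \<Omega> ?J" by (rule inj_on_inverseI[of _ W]) (rule W_\<Omega>)
  ultimately have surj: "\<Omega> ` ?J = ?J" by (rule endo_inj_surj[OF finite])
  have "m u b \<in> ?J'" if "u \<in> ?J" for u b
  proof -
    have "u \<in> \<Omega> ` ?J" using that by (simp only: surj)
    then obtain a where a: "a \<in> ?J" "u = \<Omega> a" by (elim imageE)
    have "fst (app (L (\<Omega> a)) (b, 0)) \<in> ?J'"
      by (rule L_mem_at[OF right_series_subgroup star_J'[OF a(1)] app_E_minus_1 star_J'[OF a(1)]
            subset_refl])
    then show ?thesis by (simp add: app_L a)
  qed
  then have "set_op m ?J UNIV \<subseteq> ?J'"
    by (rule set_op_least[OF right_series_subgroup])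
  then show ?case using set_op_mono[OF Suc subset_refl[of UNIV], of m] unfolding right_series.simps(2)
    by (rule order_trans[rotated])
qed simp

lemma right_nilpotent_star_iff: "right_nilpotent star \<longleftrightarrow> right_nilpotent m"
proof -
  have "right_series star i = right_series m i" for i
    using right_series_star_subset right_series_subset_star by blast
  then show ?thesis by (simp add: right_nilpotent_def)
qed

end

section \<open>Recovering the pre-Lie product from the brace\<close>

lemma flow_circ_inj:
  assumes "flows n P q m1" "flows n P q m2" "flow_circ n m1 = flow_circ n m2"
  shows "m1 = m2"
proof (intro ext)
  interpret f1: flows n P q m1 by fact
  interpret f2: flows n P q m2 by fact
  fix u b
  define a where "a = Wmap n m1 u"
  have u: "Omega n m1 a = u" by (simp add: a_def)
  have "f1.E (Omega n m1 a) = f2.E (Omega n m2 a)"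
  proof (rule opr_eqI_affine)
    show "app (f1.E (Omega n m1 a)) (b, 1) = app (f2.E (Omega n m2 a)) (b, 1)" for b
      by (simp add: f1.app_E_1 f2.app_E_1 assms(3))
  qed
  \<comment> \<open>Both operators live in the same ring, so injectivity of \<open>texp\<close>
    applies although they come from different products.\<close>
  then have "f1.L u = f2.L (Omega n m2 a)"
    unfolding f1.E_def f2.E_def u
    by (rule f1.texp_inj[OF f1.L_nil f2.L_nil f1.L_torsion f2.L_torsion])
  then have "app (f1.L u) (s, k) = app (f2.L (Omega n m2 a)) (s, k)" for s k by simp
  \<comment> \<open>The value at \<open>(0, 1)\<close> gives \<open>u = Omega n m2 a\<close>; the
    value at \<open>(b, 0)\<close> then compares the products.\<close>
  from this[of 0 1] this[of b 0] show "m1 u b = m2 u b"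
    by (simp add: f1.app_L f2.app_L)
qed

theorem theorem2:
  fixes p n :: nat and m :: "'a::{ab_group_add, finite} \<Rightarrow> 'a \<Rightarrow> 'a"
  assumes "prime p" and "n + 1 < p" and "card (UNIV :: 'a set) = p ^ n"
    and "pre_lie m" and "left_nilpotent m"
  shows "brace (flow_circ n m)
     \<and> left_nilpotent (brace_star (flow_circ n m))
     \<and> (right_nilpotent (brace_star (flow_circ n m)) \<longleftrightarrow> right_nilpotent m)
     \<and> (\<forall>m1 m2 :: 'a \<Rightarrow> 'a \<Rightarrow> 'a. pre_lie m1 \<and> left_nilpotent m1 \<and> pre_lie m2 \<and> left_nilpotent m2
          \<and> m1 \<noteq> m2 \<longrightarrow> flow_circ n m1 \<noteq> flow_circ n m2)"
proof (intro conjI allI impI)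
  have "coprime (fact j) (p ^ n)" if "j \<le> n" for j
    using assms(1,2) that by (simp add: prime_dvd_fact_iff prime_imp_coprime coprime_commute)
  then have "\<exists>k. [k * fact j = 1] (mod p ^ n)" if "j \<le> n" for j
    using cong_solve_coprime_nat[of "fact j" "p ^ n"] that by (metis One_nat_def mult.commute)
  then obtain r where r: "\<And>j. j \<le> n \<Longrightarrow> [r j * fact j = 1] (mod p ^ n)" by metis
  \<comment> \<open>The congruence fixes \<open>r 0\<close> only modulo \<open>p ^ n\<close>,
    whereas \<open>q 0\<close> must be 1 exactly.\<close>
  define q where "q = r(0 := 1)"
  have flows: "flows n (p ^ n) q m'" if "pre_lie m'" "left_nilpotent m'" for m' :: "'a \<Rightarrow> 'a \<Rightarrow> 'a"
  proof unfold_locales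
    show "q 0 = 1" by (simp add: q_def)
    show "[q j * fact j = 1] (mod p ^ n)" if "j \<le> n" for j
      using r[OF that] by (simp add: q_def)
    show "left_series m' n = {0}"
      by (rule left_series_eq_zero[OF assms(1,3) that(2)])
  qed (use that assms(3) in auto)
  interpret flows n "p ^ n" q m by (rule flows[OF assms(4,5)])
  show "brace (flow_circ n m)" by (rule brace_circ)
  show "left_nilpotent (brace_star (flow_circ n m))" by (rule left_nilpotent_star)
  show "right_nilpotent (brace_star (flow_circ n m)) = right_nilpotent m"
    by (rule right_nilpotent_star_iff)
  show "flow_circ n m1 \<noteq> flow_circ n m2"
    if "pre_lie m1 \<and> left_nilpotent m1 \<and> pre_lie m2 \<and> left_nilpotent m2 \<and> m1 \<noteq> m2"
    for m1 m2 :: "'a \<Rightarrow> 'a \<Rightarrow> 'a"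
    using flow_circ_inj[OF flows flows, of m1 m2] that by blast
qed

end
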